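(* Let $\sigma=0.2$, let $m,n\ge 1$ and $k,j\ge 2$ be integers, and let $f:\mathbb{R}^2\to\mathbb{R}$, $(\mu,\nu)\mapsto f(\mu,\nu)$, be a differentiable map with partial derivatives $f_\mu,f_\nu$. Let $\bar\mu_{m,1},\bar\mu_{m,k},\bar\nu_{n,1},\bar\nu_{n,j}$ and the functions $\mu_{m,1}(\ell),\mu_{m,k}(\ell),\nu_{n,1}(\ell),\nu_{n,j}(\ell)$, $\Phi^m,\Upsilon^m,\Psi^n,\Gamma^n$ be as defined in the context. Then the functions $\ell\mapsto f(\mu_{m,1}(\ell),\nu_{n,1}(\ell))$, $\ell\mapsto f(\mu_{m,k}(\ell),\nu_{n,1}(\ell))$, $\ell\mapsto f(\mu_{m,1}(\ell),\nu_{n,j}(\ell))$, $\ell\mapsto f(\mu_{m,k}(\ell),\nu_{n,j}(\ell))$ (the first two being considered only for those $n$ for which $\bar\nu_{n,1}$ exists) are differentiable and their derivatives at $\ell=\pi/150$ are $$\frac{d}{d\ell}\big(f(\mu_{m,1}(\ell),\nu_{n,1}(\ell))\big)\Big|_{\ell=\frac{\pi}{150}}=-f_{\mu}(\bar\mu_{m,1},\bar\nu_{n,1})\frac{\Phi^m_\ell(\bar\mu_{m,1},\frac{\pi}{150})}{\Phi^m_\lambda(\bar\mu_{m,1},\frac{\pi}{150})}-f_{\nu}(\bar\mu_{m,1},\bar\nu_{n,1})\frac{\Gamma^n_\ell(\bar\nu_{n,1},\frac{\pi}{150})}{\Gamma^n_\lambda(\bar\nu_{n,1},\frac{\pi}{150})},$$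 $$\frac{d}{d\ell}\big(f(\mu_{m,k}(\ell),\nu_{n,1}(\ell))\big)\Big|_{\ell=\frac{\pi}{150}}=-f_{\mu}(\bar\mu_{m,k},\bar\nu_{n,1})\frac{\Upsilon^m_\ell(\bar\mu_{m,k},\frac{\pi}{150})}{\Upsilon^m_\lambda(\bar\mu_{m,k},\frac{\pi}{150})}-f_{\nu}(\bar\mu_{m,k},\bar\nu_{n,1})\frac{\Gamma^n_\ell(\bar\nu_{n,1},\frac{\pi}{150})}{\Gamma^n_\lambda(\bar\nu_{n,1},\frac{\pi}{150})},$$ $$\frac{d}{d\ell}\big(f(\mu_{m,1}(\ell),\nu_{n,j}(\ell))\big)\Big|_{\ell=\frac{\pi}{150}}=-f_{\mu}(\bar\mu_{m,1},\bar\nu_{n,j})\frac{\Phi^m_\ell(\bar\mu_{m,1},\frac{\pi}{150})}{\Phi^m_\lambda(\bar\mu_{m,1},\frac{\pi}{150})}-f_{\nu}(\bar\mu_{m,1},\bar\nu_{n,j})\frac{\Psi^n_\ell(\bar\nu_{n,j},\frac{\pi}{150})}{\Psi^n_\lambda(\bar\nu_{n,j},\frac{\pi}{150})},$$ $$\frac{d}{d\ell}\big(f(\mu_{m,k}(\ell),\nu_{n,j}(\ell))\big)\Big|_{\ell=\frac{\pi}{150}}=-f_{\mu}(\bar\mu_{m,k},\bar\nu_{n,j})\frac{\Upsilon^m_\ell(\bar\mu_{m,k},\frac{\pi}{150})}{\Upsilon^m_\lambda(\bar\mu_{m,k},\frac{\pi}{150})}-f_{\nu}(\bar\mu_{m,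k},\bar\nu_{n,j})\frac{\Psi^n_\ell(\bar\nu_{n,j},\frac{\pi}{150})}{\Psi^n_\lambda(\bar\nu_{n,j},\frac{\pi}{150})}.$$
   Context: For integers $m,n\ge1$, $\ell>0$, $\lambda>0$ and $\sigma=0.2$ set $$\Phi^m(\lambda,\ell)=\sqrt{m^2-\lambda^{1/2}}\,(\lambda^{1/2}+(1-\sigma)m^2)^2\tanh(\ell\sqrt{m^2-\lambda^{1/2}})-\sqrt{m^2+\lambda^{1/2}}\,(\lambda^{1/2}-(1-\sigma)m^2)^2\tanh(\ell\sqrt{m^2+\lambda^{1/2}})\quad(\lambda<m^4),$$ $$\Upsilon^m(\lambda,\ell)=\sqrt{\lambda^{1/2}-m^2}\,(\lambda^{1/2}+(1-\sigma)m^2)^2\tan(\ell\sqrt{\lambda^{1/2}-m^2})+\sqrt{\lambda^{1/2}+m^2}\,(\lambda^{1/2}-(1-\sigma)m^2)^2\tanh(\ell\sqrt{\lambda^{1/2}+m^2})\quad(\lambda>m^4),$$ $$\Psi^n(\lambda,\ell)=\sqrt{\lambda^{1/2}-n^2}\,(\lambda^{1/2}+(1-\sigma)n^2)^2\tanh(\ell\sqrt{\lambda^{1/2}+n^2})-\sqrt{\lambda^{1/2}+n^2}\,(\lambda^{1/2}-(1-\sigma)n^2)^2\tan(\ell\sqrt{\lambda^{1/2}-n^2})\quad(\lambda>n^4),$$ $$\Gamma^n(\lambda,\ell)=\sqrt{n^2-\lambda^{1/2}}\,(\lambda^{1/2}+(1-\sigma)n^2)^2\tanh(\ell\sqrt{\lambda^{1/2}+n^2})-\sqrt{\lambda^{1/2}+n^2}\,(\lambda^{1/2}-(1-\sigma)n^2)^2\tanh(\ell\sqrt{n^2-\lambda^{1/2}})\quad(\lambda<n^4).$$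 Subscripts $\ell$ and $\lambda$ on these functions denote partial derivatives. For $\ell=\pi/150$: $\bar\mu_{m,1}$ is the unique $\lambda\in((1-\sigma^2)m^4,m^4)$ with $\Phi^m(\lambda,\ell)=0$; $\bar\mu_{m,k}$ ($k\ge2$) is the $(k-1)$-th solution, in increasing order, $\lambda>m^4$ of $\Upsilon^m(\lambda,\ell)=0$; $\bar\nu_{n,j}$ ($j\ge2$) is the $(j-1)$-th solution, in increasing order, $\lambda>n^4$ of $\Psi^n(\lambda,\ell)=0$; $\bar\nu_{n,1}$ is the unique $\lambda\in((1-\sigma^2)n^4,n^4)$ with $\Gamma^n(\lambda,\ell)=0$, which exists if $\ell n\sqrt2\coth(\ell n\sqrt2)>\left(\frac{2-\sigma}{\sigma}\right)^2$ (it does not exist for $1\le n\le 2734$). These numbers are the eigenvalues of $\Delta^2u=\lambda u$ on the partially hinged plate $(0,\pi)\times(-\ell,\ell)$ with Poisson ratio $\sigma$. The functions $\mu_{m,1}(\ell)$, $\mu_{m,k}(\ell)$, $\nu_{n,1}(\ell)$, $\nu_{n,j}(\ell)$ are the smooth functions defined near $\ell=\pi/150$ through the Implicit Function Theorem by the relations $\Phi^m(\mu_{m,1}(\ell),\ell)=0$, $\Upsilon^m(\mu_{m,k}(\ell),\ell)=0$, $\Gamma^n(\nu_{n,1}(\ell),\ell)=0$, $\Psi^n(\nu_{n,j}(\ell),\ell)=0$ with values $\bar\mu_{m,1},\bar\mu_{m,k},\bar\nu_{n,1},\bar\nu_{n,j}$ at $\ell=\pi/150$, respectively. *)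

theory Defs
  imports "HOL-Analysis.Analysis"
begin

definition sigma :: real where "sigma = 0.2"

text \<open>
  The four functions are total here, but each is used only on the range of \<open>lam\<close> named in its comment;
  there all arguments of \<open>sqrt\<close> are positive. At a pole of \<open>tan\<close> the library value
  is \<open>0\<close>, so that \<open>Upsilon\<close> and \<open>Psi\<close> are strictly positive there and poles do not contribute
  solutions.
\<close>

definition Phi :: "nat \<Rightarrow> real \<Rightarrow> real \<Rightarrow> real" where \<comment> \<open>\<open>0 < lam < m^4\<close>\<close>
  "Phi m lam l =
     sqrt (real m ^ 2 - sqrt lam) * (sqrt lam + (1 - sigma) * real m ^ 2) ^ 2
       * tanh (l * sqrt (real m ^ 2 - sqrt lam))
   - sqrt (real m ^ 2 + sqrt lam) * (sqrt lam - (1 - sigma) * real m ^ 2) ^ 2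
       * tanh (l * sqrt (real m ^ 2 + sqrt lam))"

definition Upsilon :: "nat \<Rightarrow> real \<Rightarrow> real \<Rightarrow> real" where \<comment> \<open>\<open>lam > m^4\<close>\<close>
  "Upsilon m lam l =
     sqrt (sqrt lam - real m ^ 2) * (sqrt lam + (1 - sigma) * real m ^ 2) ^ 2
       * tan (l * sqrt (sqrt lam - real m ^ 2))
   + sqrt (sqrt lam + real m ^ 2) * (sqrt lam - (1 - sigma) * real m ^ 2) ^ 2
       * tanh (l * sqrt (sqrt lam + real m ^ 2))"

definition Psi :: "nat \<Rightarrow> real \<Rightarrow> real \<Rightarrow> real" where \<comment> \<open>\<open>lam > n^4\<close>\<close>
  "Psi n lam l =
     sqrt (sqrt lam - real n ^ 2) * (sqrt lam + (1 - sigma) * real n ^ 2) ^ 2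
       * tanh (l * sqrt (sqrt lam + real n ^ 2))
   - sqrt (sqrt lam + real n ^ 2) * (sqrt lam - (1 - sigma) * real n ^ 2) ^ 2
       * tan (l * sqrt (sqrt lam - real n ^ 2))"

definition Gamma_fun :: "nat \<Rightarrow> real \<Rightarrow> real \<Rightarrow> real" where \<comment> \<open>\<open>0 < lam < n^4\<close>\<close>
  "Gamma_fun n lam l =
     sqrt (real n ^ 2 - sqrt lam) * (sqrt lam + (1 - sigma) * real n ^ 2) ^ 2
       * tanh (l * sqrt (sqrt lam + real n ^ 2))
   - sqrt (sqrt lam + real n ^ 2) * (sqrt lam - (1 - sigma) * real n ^ 2) ^ 2
       * tanh (l * sqrt (real n ^ 2 - sqrt lam))"

definition partial_fst :: "(real \<Rightarrow> real \<Rightarrow> real) \<Rightarrow> real \<Rightarrow> real \<Rightarrow> real" where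
  "partial_fst F a b = deriv (\<lambda>x. F x b) a"

definition partial_snd :: "(real \<Rightarrow> real \<Rightarrow> real) \<Rightarrow> real \<Rightarrow> real \<Rightarrow> real" where
  "partial_snd F a b = deriv (\<lambda>y. F a y) b"

definition root_between :: "(real \<Rightarrow> real) \<Rightarrow> real \<Rightarrow> real \<Rightarrow> real \<Rightarrow> bool" where
  "root_between F a b x \<longleftrightarrow> a < x \<and> x < b \<and> F x = 0"

text \<open>\<open>nth_root_above F a i x\<close>: \<open>x\<close> is the \<open>i\<close>-th solution of \<open>F = 0\<close> above \<open>a\<close> in increasing order,
  counted from \<open>i = 1\<close>. Finiteness is required because \<open>card\<close> of an infinite set is \<open>0\<close>.\<close>

definition nth_root_above :: "(real \<Rightarrow> real) \<Rightarrow> real \<Rightarrow> nat \<Rightarrow> real \<Rightarrow> bool" where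
  "nth_root_above F a i x \<longleftrightarrow> a < x \<and> F x = 0 \<and>
     finite {y. a < y \<and> y < x \<and> F y = 0} \<and>
     Suc (card {y. a < y \<and> y < x \<and> F y = 0}) = i"

definition mubar :: "nat \<Rightarrow> nat \<Rightarrow> real" where
  "mubar m k =
     (if k = 1
      then THE x. root_between (\<lambda>lam. Phi m lam (pi/150)) ((1 - sigma^2) * real m ^ 4) (real m ^ 4) x
      else THE x. nth_root_above (\<lambda>lam. Upsilon m lam (pi/150)) (real m ^ 4) (k - 1) x)"

definition nubar :: "nat \<Rightarrow> nat \<Rightarrow> real" where
  "nubar n j =
     (if j = 1
      then THE x. root_between (\<lambda>lam. Gamma_fun n lam (pi/150)) ((1 - sigma^2) * real n ^ 4) (real n ^ 4) x
      else THE x. nth_root_above (\<lambda>lam. Psi n lam (pi/150)) (real n ^ 4) (j - 1) x)"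

definition nubar_one_exists :: "nat \<Rightarrow> bool" where
  "nubar_one_exists n \<longleftrightarrow>
     (\<exists>x. root_between (\<lambda>lam. Gamma_fun n lam (pi/150)) ((1 - sigma^2) * real n ^ 4) (real n ^ 4) x)"

definition smooth_near :: "(real \<Rightarrow> real) \<Rightarrow> real \<Rightarrow> bool" where
  "smooth_near g x0 \<longleftrightarrow>
     (\<exists>U. open U \<and> x0 \<in> U \<and> (\<forall>i. \<forall>x\<in>U. ((deriv ^^ i) g) differentiable (at x)))"

text \<open>\<open>implicit_branch F a b g\<close>: \<open>g\<close> is smooth near \<open>b\<close>, \<open>g b = a\<close>, and \<open>F (g l) l = 0\<close> for \<open>l\<close> near \<open>b\<close>.
  Such a \<open>g\<close> is determined only as a germ at \<open>b\<close>, so \<open>implicit_fun\<close> chooses a representative, with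
  irrelevant values away from \<open>b\<close>.\<close>

definition implicit_branch ::
    "(real \<Rightarrow> real \<Rightarrow> real) \<Rightarrow> real \<Rightarrow> real \<Rightarrow> (real \<Rightarrow> real) \<Rightarrow> bool" where
  "implicit_branch F a b g \<longleftrightarrow>
     smooth_near g b \<and> g b = a \<and> (\<forall>\<^sub>F l in nhds b. F (g l) l = 0)"

definition implicit_fun :: "(real \<Rightarrow> real \<Rightarrow> real) \<Rightarrow> real \<Rightarrow> real \<Rightarrow> real \<Rightarrow> real" where
  "implicit_fun F a b = (SOME g. implicit_branch F a b g)"

definition mu :: "nat \<Rightarrow> nat \<Rightarrow> real \<Rightarrow> real" where
  "mu m k = implicit_fun (if k = 1 then Phi m else Upsilon m) (mubar m k) (pi/150)"

definition nu :: "nat \<Rightarrow> nat \<Rightarrow> real \<Rightarrow> real" where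
  "nu n j = implicit_fun (if j = 1 then Gamma_fun n else Psi n) (nubar n j) (pi/150)"

end

theory Submission
  imports Defs
begin

text \<open>
  The four formulas are the chain rule combined with the implicit function theorem; what has to be
  proved is that the theorem applies, that is, that \<open>mubar m k\<close> and \<open>nubar n j\<close> are well defined
  (for \<open>nubar n 1\<close>: unique, its existence being a hypothesis) and
  that the partial derivative in \<open>lam\<close> of the defining function does not vanish there.

  Both follow from one monotonicity observation. Put \<open>s = sqrt lam\<close>, \<open>N = m\<^sup>2\<close>, \<open>c = (1 - sigma) N\<close> and
  \<open>rho s = ((s + c) / (s - c))\<^sup>2\<close>, which is decreasing for \<open>s > c\<close>. As functions of \<open>z\<^sup>2\<close>,
  \<open>z tanh (l z)\<close> increases and \<open>tanh (l z) / z\<close> decreases, while \<open>z tan (l z)\<close> and \<open>tan (l z) / z\<close>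
  increase on each branch of the tangent. With \<open>a = sqrt (N - s)\<close>, \<open>\<alpha> = sqrt (s - N)\<close> and
  \<open>\<beta> = sqrt (s + N)\<close>, dividing by a nonvanishing factor turns the defining functions into

  \<^item> \<open>rho s * (a tanh (l a)) - \<beta> tanh (l \<beta>)\<close> for \<open>Phi\<close>,
  \<^item> \<open>rho s * (\<alpha> tan (l \<alpha>)) + \<beta> tanh (l \<beta>)\<close> for \<open>Upsilon\<close>,
  \<^item> \<open>rho s * (tanh (l \<beta>) / \<beta>) - tan (l \<alpha>) / \<alpha>\<close> for \<open>Psi\<close>,
  \<^item> \<open>rho s * (tanh (l \<beta>) / \<beta>) - tanh (l a) / a\<close> for \<open>Gamma_fun\<close>.

  The first and the last have negative derivative in \<open>s\<close>, the third has negative derivative off the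
  poles, and the second has positive derivative where the tangent is negative, the only place
  where it can vanish. So zeros are simple, there is at most one of them below \<open>m^4\<close> in the window
  considered, and at most one on each branch of the tangent above \<open>m^4\<close>. Sign changes
  provide a zero of \<open>Phi\<close> (lemma \<open>Phi_ex1_root\<close>) and one zero of \<open>Upsilon\<close> and of \<open>Psi\<close> on each branch
  of index at least \<open>1\<close> (lemmas \<open>Upsilon_ex1_root\<close>, \<open>Psi_ex1_root\<close>), so that the zeros can be numbered.

  The implicit functions have to be smooth and not merely differentiable. For this the
  two-variable functions are placed in a class \<open>elementary\<close> that is closed under partial derivatives: if
  \<open>F (g l) l = 0\<close>, then \<open>g'\<close> and inductively all derivatives of \<open>g\<close> are members of the class evaluated
  at \<open>(g l, l)\<close> (lemma \<open>elementary_implicit_branch\<close>).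
\<close>

section \<open>Smooth implicit functions of elementary functions of two variables\<close>

text \<open>\<open>elementary W F\<close>: \<open>F\<close> is built from constants, the two coordinates, sums, products,
  inverses, \<open>sqrt\<close>, \<open>tanh\<close> and \<open>tan\<close>, and on \<open>W\<close> every inverse, square root and tangent in it is
  taken at a point where that operation is differentiable. Off \<open>W\<close> nothing is required. The point
  of the class is that it is closed under partial derivatives, so membership replaces
  \<open>C\<^sup>\<infinity>\<close> regularity in two variables.\<close>

inductive elementary :: "(real \<times> real) set \<Rightarrow> (real \<times> real \<Rightarrow> real) \<Rightarrow> bool"
  for W :: "(real \<times> real) set"
where
  elementary_const: "elementary W (\<lambda>p. c)"
| elementary_fst: "elementary W fst"
| elementary_snd: "elementary W snd"
| elementary_add: "elementary W F \<Longrightarrow> elementary W G \<Longrightarrow> elementary W (\<lambda>p. F p + G p)"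
| elementary_mult: "elementary W F \<Longrightarrow> elementary W G \<Longrightarrow> elementary W (\<lambda>p. F p * G p)"
| elementary_inverse:
    "elementary W F \<Longrightarrow> \<forall>p\<in>W. F p \<noteq> 0 \<Longrightarrow> elementary W (\<lambda>p. inverse (F p))"
| elementary_sqrt: "elementary W F \<Longrightarrow> \<forall>p\<in>W. F p > 0 \<Longrightarrow> elementary W (\<lambda>p. sqrt (F p))"
| elementary_tanh: "elementary W F \<Longrightarrow> elementary W (\<lambda>p. tanh (F p))"
| elementary_tan: "elementary W F \<Longrightarrow> \<forall>p\<in>W. cos (F p) \<noteq> 0 \<Longrightarrow> elementary W (\<lambda>p. tan (F p))"

lemma elementary_minus: "elementary W F \<Longrightarrow> elementary W (\<lambda>p. - F p)"
  using elementary_mult[OF elementary_const[of W "-1"]] by fastforce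

lemma elementary_diff:
  "elementary W F \<Longrightarrow> elementary W G \<Longrightarrow> elementary W (\<lambda>p. F p - G p)"
  using elementary_add[OF _ elementary_minus] by fastforce

lemma elementary_divide:
  "elementary W F \<Longrightarrow> elementary W G \<Longrightarrow> \<forall>p\<in>W. G p \<noteq> 0 \<Longrightarrow> elementary W (\<lambda>p. F p / G p)"
  using elementary_mult[OF _ elementary_inverse] by (fastforce simp: divide_inverse)

lemma elementary_power2: "elementary W F \<Longrightarrow> elementary W (\<lambda>p. (F p) ^ 2)"
  unfolding power2_eq_square by (rule elementary_mult)

lemmas elementary_rules =
  elementary_const elementary_fst elementary_snd elementary_add elementary_mult
  elementary_inverse elementary_sqrt elementary_tanh elementary_tan
  elementary_minus elementary_diff elementary_divide elementary_power2

lemma elementary_subset: "elementary W F \<Longrightarrow> V \<subseteq> W \<Longrightarrow> elementary V F"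
  by (induction rule: elementary.induct) (auto intro: elementary.intros)

lemma elementary_comp_has_derivative:
  fixes F :: "real \<times> real \<Rightarrow> real"
  assumes F: "(F has_derivative (\<lambda>h. Fx p * fst h + Fy p * snd h)) (at p)"
    and phi: "(phi has_real_derivative d) (at (F p))"
  shows "((\<lambda>p. phi (F p)) has_derivative (\<lambda>h. (d * Fx p) * fst h + (d * Fy p) * snd h)) (at p)"
proof -
  have "((\<lambda>p. phi (F p)) has_derivative (\<lambda>h. d * (Fx p * fst h + Fy p * snd h))) (at p)"
    using has_derivative_compose[OF F, of phi "\<lambda>h. d * h"] phi
    by (simp add: has_field_derivative_def)
  then show ?thesis by (simp add: algebra_simps)
qed

lemma elementary_has_partials:
  assumes "elementary W F"
  shows "\<exists>Fx Fy. elementary W Fx \<and> elementary W Fy \<and>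
    (\<forall>p\<in>W. (F has_derivative (\<lambda>h. Fx p * fst h + Fy p * snd h)) (at p))"
  using assms
proof (induction rule: elementary.induct)
  case (elementary_const c)
  then show ?case
    by (intro exI[of _ "\<lambda>p. 0"]) (auto intro: elementary.intros)
next
  case elementary_fst
  then show ?case
    by (intro exI[of _ "\<lambda>p. 1"] exI[of _ "\<lambda>p. 0"])
       (auto intro: elementary.intros intro!: derivative_eq_intros)
next
  case elementary_snd
  then show ?case
    by (intro exI[of _ "\<lambda>p. 0"] exI[of _ "\<lambda>p. 1"])
       (auto intro: elementary.intros intro!: derivative_eq_intros)
next
  case (elementary_add F G)
  then obtain Fx Fy Gx Gy where *: "elementary W Fx" "elementary W Fy" "elementary W Gx" "elementary W Gy"
    "\<forall>p\<in>W. (F has_derivative (\<lambda>h. Fx p * fst h + Fy p * snd h)) (at p)"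
    "\<forall>p\<in>W. (G has_derivative (\<lambda>h. Gx p * fst h + Gy p * snd h)) (at p)" by blast
  show ?case
  proof (intro exI conjI ballI)
    fix p assume "p \<in> W"
    with * show "((\<lambda>p. F p + G p) has_derivative
        (\<lambda>h. (Fx p + Gx p) * fst h + (Fy p + Gy p) * snd h)) (at p)"
      by (auto intro!: derivative_eq_intros simp: algebra_simps)
  qed (auto intro: elementary_rules *)
next
  case (elementary_mult F G)
  then obtain Fx Fy Gx Gy where *: "elementary W Fx" "elementary W Fy" "elementary W Gx" "elementary W Gy"
    "\<forall>p\<in>W. (F has_derivative (\<lambda>h. Fx p * fst h + Fy p * snd h)) (at p)"
    "\<forall>p\<in>W. (G has_derivative (\<lambda>h. Gx p * fst h + Gy p * snd h)) (at p)" by blast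
  show ?case
  proof (intro exI conjI ballI)
    fix p assume "p \<in> W"
    with * show "((\<lambda>p. F p * G p) has_derivative
        (\<lambda>h. (Fx p * G p + F p * Gx p) * fst h + (Fy p * G p + F p * Gy p) * snd h)) (at p)"
      by (auto intro!: derivative_eq_intros simp: algebra_simps)
  qed (intro elementary_rules * elementary_mult.hyps)+
next
  case (elementary_inverse F)
  then obtain Fx Fy where *: "elementary W Fx" "elementary W Fy"
    "\<forall>p\<in>W. (F has_derivative (\<lambda>h. Fx p * fst h + Fy p * snd h)) (at p)" by blast
  let ?d = "\<lambda>p. - (inverse (F p) * inverse (F p))"
  show ?case
  proof (intro exI conjI ballI)
    fix p assume "p \<in> W"
    then show "((\<lambda>p. inverse (F p)) has_derivative
        (\<lambda>h. (?d p * Fx p) * fst h + (?d p * Fy p) * snd h)) (at p)"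
      using * elementary_inverse.hyps
      by (intro elementary_comp_has_derivative) (auto intro!: derivative_eq_intros)
  qed (intro elementary_rules * elementary_inverse.hyps)+
next
  case (elementary_sqrt F)
  then obtain Fx Fy where *: "elementary W Fx" "elementary W Fy"
    "\<forall>p\<in>W. (F has_derivative (\<lambda>h. Fx p * fst h + Fy p * snd h)) (at p)" by blast
  let ?d = "\<lambda>p. inverse (sqrt (F p)) / 2"
  have nz: "\<forall>p\<in>W. sqrt (F p) \<noteq> 0" using elementary_sqrt.hyps by force
  show ?case
  proof (intro exI conjI ballI)
    fix p assume "p \<in> W"
    then show "((\<lambda>p. sqrt (F p)) has_derivative
        (\<lambda>h. (?d p * Fx p) * fst h + (?d p * Fy p) * snd h)) (at p)"
      using * elementary_sqrt.hyps
      by (intro elementary_comp_has_derivative) (auto intro!: derivative_eq_intros simp: field_simps)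
  qed (intro elementary_rules * elementary_sqrt.hyps nz | simp)+
next
  case (elementary_tanh F)
  then obtain Fx Fy where *: "elementary W Fx" "elementary W Fy"
    "\<forall>p\<in>W. (F has_derivative (\<lambda>h. Fx p * fst h + Fy p * snd h)) (at p)" by blast
  let ?d = "\<lambda>p. 1 - (tanh (F p))\<^sup>2"
  show ?case
  proof (intro exI conjI ballI)
    fix p assume "p \<in> W"
    then show "((\<lambda>p. tanh (F p)) has_derivative
        (\<lambda>h. (?d p * Fx p) * fst h + (?d p * Fy p) * snd h)) (at p)"
      using * by (intro elementary_comp_has_derivative) (auto intro!: derivative_eq_intros)
  qed (intro elementary_rules * elementary_tanh.hyps)+
next
  case (elementary_tan F)
  then obtain Fx Fy where *: "elementary W Fx" "elementary W Fy"
    "\<forall>p\<in>W. (F has_derivative (\<lambda>h. Fx p * fst h + Fy p * snd h)) (at p)" by blast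
  let ?d = "\<lambda>p. 1 + (tan (F p))\<^sup>2"
  show ?case
  proof (intro exI conjI ballI)
    fix p assume "p \<in> W"
    then show "((\<lambda>p. tan (F p)) has_derivative
        (\<lambda>h. (?d p * Fx p) * fst h + (?d p * Fy p) * snd h)) (at p)"
      using * elementary_tan.hyps
      by (intro elementary_comp_has_derivative)
         (auto simp: tan_sec power_inverse intro!: DERIV_tan)
  qed (intro elementary_rules * elementary_tan.hyps)+
qed

lemma has_real_derivative_along_graph:
  assumes F: "(F has_derivative (\<lambda>h. A * fst h + B * snd h)) (at (g l, l))"
    and g: "(g has_real_derivative g') (at l)"
  shows "((\<lambda>l. F (g l, l)) has_real_derivative (A * g' + B)) (at l)"
proof -
  have "((\<lambda>l. (g l, l)) has_derivative (\<lambda>h. (g' * h, h))) (at l)"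
    using g by (auto intro!: derivative_eq_intros simp: has_field_derivative_def)
  from has_derivative_compose[OF this, of F "\<lambda>h. A * fst h + B * snd h"] F show ?thesis
    unfolding has_field_derivative_def
    by (auto elim!: has_derivative_eq_rhs simp: algebra_simps)
qed

text \<open>If \<open>g\<close> solves the differential equation \<open>g' l = R (g l, l)\<close> with \<open>R\<close> elementary, then every
  iterated derivative of \<open>g\<close> is an elementary function of \<open>(g l, l)\<close>: differentiating one and
  substituting the equation for \<open>g'\<close> gives the next.\<close>

lemma elementary_graph_iterated_deriv:
  assumes U: "open U"
    and gW: "\<And>l. l \<in> U \<Longrightarrow> (g l, l) \<in> W"
    and R: "elementary W R"
    and g: "\<And>l. l \<in> U \<Longrightarrow> (g has_real_derivative R (g l, l)) (at l)"
  shows "\<exists>E. elementary W E \<and> (\<forall>l\<in>U. (deriv ^^ i) g l = E (g l, l) \<and>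
           (deriv ^^ i) g differentiable (at l))"
proof -
  have step: "\<exists>E'. elementary W E' \<and> (\<forall>l\<in>U. (h has_real_derivative E' (g l, l)) (at l))"
    if E: "elementary W E" and h: "\<forall>l\<in>U. h l = E (g l, l)" for E h
  proof -
    obtain Ex Ey where *: "elementary W Ex" "elementary W Ey"
      "\<forall>p\<in>W. (E has_derivative (\<lambda>h. Ex p * fst h + Ey p * snd h)) (at p)"
      using elementary_has_partials[OF E] by blast
    have "(h has_real_derivative (Ex (g l, l) * R (g l, l) + Ey (g l, l))) (at l)"
      if l: "l \<in> U" for l
    proof (rule DERIV_cong_ev[THEN iffD2, OF refl _ refl])
      show "\<forall>\<^sub>F x in nhds l. h x = E (g x, x)"
        using eventually_nhds_in_open[OF U l] by eventually_elim (use h in auto)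
      show "((\<lambda>l. E (g l, l)) has_real_derivative
          (Ex (g l, l) * R (g l, l) + Ey (g l, l))) (at l)"
        using has_real_derivative_along_graph * gW g l by blast
    qed
    then show ?thesis
      by (intro exI[of _ "\<lambda>p. Ex p * R p + Ey p"]) (auto intro!: elementary_rules * R)
  qed
  have "\<exists>E. elementary W E \<and> (\<forall>l\<in>U. (deriv ^^ i) g l = E (g l, l))"
  proof (induction i)
    case 0
    show ?case by (intro exI[of _ fst]) (auto intro: elementary_fst)
  next
    case (Suc i)
    then obtain E where "elementary W E" "\<forall>l\<in>U. (deriv ^^ i) g l = E (g l, l)" by blast
    from step[OF this] show ?case by (auto dest!: DERIV_imp_deriv)
  qed
  then obtain E where E: "elementary W E" "\<forall>l\<in>U. (deriv ^^ i) g l = E (g l, l)" by blast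
  from step[OF this] E show ?thesis by (metis real_differentiable_def)
qed

text \<open>Existence of the smooth implicit function. The inverse function theorem for
  \<open>(x, y) \<mapsto> (F x y, y)\<close> gives a differentiable \<open>g\<close>; its derivative is \<open>- F\<^sub>y / F\<^sub>x\<close> along the graph,
  an elementary function once the domain is restricted to \<open>F\<^sub>x \<noteq> 0\<close>.\<close>

lemma elementary_implicit_branch:
  fixes F :: "real \<Rightarrow> real \<Rightarrow> real"
  assumes W: "open W" "(a, b) \<in> W" and F: "elementary W (\<lambda>p. F (fst p) (snd p))"
    and root: "F a b = 0" and nz: "partial_fst F a b \<noteq> 0"
  shows "\<exists>g. implicit_branch F a b g"
proof -
  define FF where "FF p = F (fst p) (snd p)" for p
  obtain Fx Fy where el: "elementary W Fx" "elementary W Fy"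
    and der: "\<And>p. p \<in> W \<Longrightarrow> (FF has_derivative (\<lambda>h. Fx p * fst h + Fy p * snd h)) (at p)"
    using elementary_has_partials[OF F] unfolding FF_def by blast
  have cont: "continuous_on W E" if "elementary W E" for E
  proof -
    from elementary_has_partials[OF that] show ?thesis
      by (meson continuous_at_imp_continuous_on has_derivative_continuous)
  qed
  have "((\<lambda>x. F x b) has_real_derivative Fx (a, b)) (at a)"
  proof -
    have "((\<lambda>x. (x, b)) has_derivative (\<lambda>h. (h, 0))) (at a)"
      by (auto intro!: derivative_eq_intros)
    from has_derivative_compose[OF this der[OF W(2)]] show ?thesis
      by (simp add: FF_def has_field_derivative_def)
  qed
  then have nz': "Fx (a, b) \<noteq> 0"
    using nz by (simp add: partial_fst_def DERIV_imp_deriv)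
  define V where "V = W \<inter> Fx -` (- {0})"
  have V: "open V" "(a, b) \<in> V" "V \<subseteq> W"
    using continuous_open_preimage[OF cont[OF el(1)] W(1), of "- {0}"] W nz'
    by (auto simp: V_def)
  define R where "R p = - (Fy p / Fx p)" for p
  have R: "elementary V R"
    unfolding R_def using el V(3)
    by (intro elementary_minus elementary_divide elementary_subset[OF _ V(3)]) (auto simp: V_def)
  define P where "P p = (FF p, snd p)" for p
  \<comment> \<open>The derivative of \<open>P\<close> is assembled from three fixed bounded linear maps, so that its
    continuity in the operator norm reduces to that of \<open>Fx\<close> and \<open>Fy\<close>.\<close>
  define B1 B2 B3 :: "(real \<times> real) \<Rightarrow>\<^sub>L (real \<times> real)"
    where "B1 = Blinfun (\<lambda>h. (fst h, 0))" and "B2 = Blinfun (\<lambda>h. (snd h, 0))"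
      and "B3 = Blinfun (\<lambda>h. (0, snd h))"
  define Bi where "Bi = Blinfun (\<lambda>h. ((fst h - Fy (a, b) * snd h) / Fx (a, b), snd h))"
  have B: "blinfun_apply B1 = (\<lambda>h. (fst h, 0))" "blinfun_apply B2 = (\<lambda>h. (snd h, 0))"
    "blinfun_apply B3 = (\<lambda>h. (0, snd h))"
    "blinfun_apply Bi = (\<lambda>h. ((fst h - Fy (a, b) * snd h) / Fx (a, b), snd h))"
    unfolding B1_def B2_def B3_def Bi_def
    by (rule bounded_linear_Blinfun_apply,
        rule linear_conv_bounded_linear[THEN iffD1],
        rule linearI; simp add: prod_eq_iff algebra_simps add_divide_distrib diff_divide_distrib)+
  define P' where "P' p = Fx p *\<^sub>R B1 + Fy p *\<^sub>R B2 + B3" for p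
  have P': "blinfun_apply (P' p) = (\<lambda>h. (Fx p * fst h + Fy p * snd h, snd h))" for p
    by (simp add: P'_def B fun_eq_iff blinfun.add_left blinfun.scaleR_left)
  have derP: "(P has_derivative blinfun_apply (P' p)) (at p)" if "p \<in> V" for p
    unfolding P' P_def[abs_def]
    by (intro has_derivative_Pair der has_derivative_snd has_derivative_ident) (use that V(3) in auto)
  have contP': "continuous_on V P'"
    unfolding P'_def using cont el V(3)
    by (intro continuous_intros) (blast intro: continuous_on_subset)+
  have inv: "Bi o\<^sub>L P' (a, b) = id_blinfun"
    by (rule blinfun_eqI) (simp add: P' B nz' prod_eq_iff)
  obtain U' V' G G' where G: "open U'" "U' \<subseteq> V" "(a, b) \<in> U'" "open V'" "P (a, b) \<in> V'"
      "homeomorphism U' V' P G"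
      "\<And>y. y \<in> V' \<Longrightarrow> (G has_derivative (G' y)) (at y)"
    using inverse_function_theorem[OF V(1) derP contP' V(2) inv] by metis
  have PG: "P (G y) = y" "G y \<in> U'" if "y \<in> V'" for y
    using G(6) that by (auto simp: homeomorphism_def)
  define g where "g l = fst (G (0, l))" for l
  define U where "U = (\<lambda>l. (0, l)) -` V' "
  have U: "open U"
    unfolding U_def using G(4) by (intro open_vimage) (auto intro!: continuous_intros)
  have Pab: "P (a, b) = (0, b)" by (simp add: P_def FF_def root)
  have bU: "b \<in> U" using G(5) Pab by (simp add: U_def)
  have gb: "g b = a" using G(3,6) Pab by (simp add: g_def homeomorphism_def) (metis fst_conv)
  have gl: "G (0, l) = (g l, l)" "F (g l) l = 0" "(g l, l) \<in> V" if "l \<in> U" for l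
  proof -
    have "P (G (0, l)) = (0, l)" "G (0, l) \<in> U'" using PG that by (auto simp: U_def)
    then show *: "G (0, l) = (g l, l)" and "F (g l) l = 0"
      by (auto simp: P_def g_def FF_def prod_eq_iff)
    show "(g l, l) \<in> V"
      using \<open>G (0, l) \<in> U'\<close> G(2) unfolding * by blast
  qed
  have gder: "(g has_real_derivative R (g l, l)) (at l)" if l: "l \<in> U" for l
  proof -
    have "((\<lambda>l. G (0, l)) has_derivative (\<lambda>h. G' (0, l) (0, h))) (at l)"
      using l by (intro has_derivative_compose[OF _ G(7)]) (auto simp: U_def intro!: derivative_eq_intros)
    then have "(g has_derivative (\<lambda>h. fst (G' (0, l) (0, h)))) (at l)"
      unfolding g_def[abs_def] by (rule has_derivative_fst)
    then obtain D where D: "(g has_real_derivative D) (at l)"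
      using differentiableI real_differentiable_def by blast
    have "((\<lambda>l. FF (g l, l)) has_real_derivative (Fx (g l, l) * D + Fy (g l, l))) (at l)"
      using has_real_derivative_along_graph[OF der D] gl(3)[OF l] V(3) by blast
    moreover have "((\<lambda>l. FF (g l, l)) has_real_derivative 0) (at l)"
    proof -
      have "\<forall>\<^sub>F l in nhds l. FF (g l, l) = 0"
        using eventually_nhds_in_open[OF U l] gl(2) by (auto elim!: eventually_mono simp: FF_def)
      from DERIV_cong_ev[OF refl this refl, of 0] show ?thesis by simp
    qed
    ultimately have "Fx (g l, l) * D + Fy (g l, l) = 0" by (rule DERIV_unique)
    then have "D = R (g l, l)"
      using gl(3)[OF l] by (simp add: R_def V_def field_simps)
    with D show ?thesis by simp
  qed
  have "smooth_near g b"
    unfolding smooth_near_def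
    using elementary_graph_iterated_deriv[OF U gl(3) R gder] U bU by (metis (no_types, lifting))
  moreover have "\<forall>\<^sub>F l in nhds b. F (g l) l = 0"
    using eventually_nhds_in_open[OF U bU] gl(2) by (auto elim: eventually_mono)
  ultimately show ?thesis using gb by (auto simp: implicit_branch_def)
qed

text \<open>Whatever representative of the germ \<open>implicit_fun\<close> chooses, it is differentiable near \<open>b\<close>,
  and differentiating \<open>F (g l) l = 0\<close> determines its derivative at \<open>b\<close>.\<close>

lemma elementary_implicit_fun:
  fixes F :: "real \<Rightarrow> real \<Rightarrow> real"
  assumes W: "open W" "(a, b) \<in> W" and F: "elementary W (\<lambda>p. F (fst p) (snd p))"
    and root: "F a b = 0" and nz: "partial_fst F a b \<noteq> 0"
  shows "implicit_fun F a b b = a"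
    and "\<forall>\<^sub>F l in nhds b. implicit_fun F a b differentiable (at l)"
    and "(implicit_fun F a b has_real_derivative - (partial_snd F a b / partial_fst F a b)) (at b)"
proof -
  let ?g = "implicit_fun F a b"
  have "implicit_branch F a b ?g"
    unfolding implicit_fun_def
    using someI_ex[OF elementary_implicit_branch[OF assms]] .
  then obtain U where gb: "?g b = a" and ev: "\<forall>\<^sub>F l in nhds b. F (?g l) l = 0"
    and U: "open U" "b \<in> U" "\<forall>i. \<forall>x\<in>U. ((deriv ^^ i) ?g) differentiable (at x)"
    unfolding implicit_branch_def smooth_near_def by blast
  show "?g b = a" by (rule gb)
  have diff: "?g differentiable (at l)" if "l \<in> U" for l
    using U(3)[rule_format, of l 0] that by simp
  then show "\<forall>\<^sub>F l in nhds b. ?g differentiable (at l)"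
    using eventually_nhds_in_open[OF U(1,2)] by (auto elim: eventually_mono)
  obtain Fx Fy where der:
    "((\<lambda>p. F (fst p) (snd p)) has_derivative (\<lambda>h. Fx (a, b) * fst h + Fy (a, b) * snd h)) (at (a, b))"
    using elementary_has_partials[OF F] W(2) by blast
  have "((\<lambda>x. F x b) has_real_derivative Fx (a, b)) (at a)"
  proof -
    have "((\<lambda>x. (x, b)) has_derivative (\<lambda>h. (h, 0))) (at a)"
      by (auto intro!: derivative_eq_intros)
    from has_derivative_compose[OF this der] show ?thesis by (simp add: has_field_derivative_def)
  qed
  then have fx: "partial_fst F a b = Fx (a, b)" by (simp add: partial_fst_def DERIV_imp_deriv)
  have "((\<lambda>y. F a y) has_real_derivative Fy (a, b)) (at b)"
  proof -
    have "((\<lambda>y. (a, y)) has_derivative (\<lambda>h. (0, h))) (at b)"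
      by (auto intro!: derivative_eq_intros)
    from has_derivative_compose[OF this der] show ?thesis by (simp add: has_field_derivative_def)
  qed
  then have fy: "partial_snd F a b = Fy (a, b)" by (simp add: partial_snd_def DERIV_imp_deriv)
  obtain D where D: "(?g has_real_derivative D) (at b)"
    using diff[OF U(2)] real_differentiable_def by blast
  have "((\<lambda>l. F (?g l) l) has_real_derivative (Fx (a, b) * D + Fy (a, b))) (at b)"
    using has_real_derivative_along_graph[where F = "\<lambda>p. F (fst p) (snd p)", OF _ D] der gb by simp
  moreover have "((\<lambda>l. F (?g l) l) has_real_derivative 0) (at b)"
    using DERIV_cong_ev[OF refl ev refl, of 0] by simp
  ultimately have "Fx (a, b) * D + Fy (a, b) = 0" by (rule DERIV_unique)
  then have "D = - (partial_snd F a b / partial_fst F a b)"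
    using nz by (simp add: fx fy field_simps)
  with D show "(?g has_real_derivative - (partial_snd F a b / partial_fst F a b)) (at b)" by simp
qed

lemma chain_rule_two_branches:
  fixes f :: "real \<Rightarrow> real \<Rightarrow> real"
  assumes f: "\<forall>p. (\<lambda>(x, y). f x y) differentiable (at p)"
    and u: "\<forall>\<^sub>F l in nhds b. u differentiable (at l)" "(u has_real_derivative - u') (at b)" "u b = x"
    and v: "\<forall>\<^sub>F l in nhds b. v differentiable (at l)" "(v has_real_derivative - v') (at b)" "v b = y"
  shows "(\<forall>\<^sub>F l in nhds b. (\<lambda>l. f (u l) (v l)) differentiable (at l)) \<and>
    ((\<lambda>l. f (u l) (v l)) has_real_derivative
      (- partial_fst f x y * u' - partial_snd f x y * v')) (at b)"
proof
  have pair: "(\<lambda>l. (u l, v l)) differentiable (at l)"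
    if uv: "u differentiable (at l)" "v differentiable (at l)" for l
    using uv unfolding differentiable_def by (blast intro: has_derivative_Pair)
  show "\<forall>\<^sub>F l in nhds b. (\<lambda>l. f (u l) (v l)) differentiable (at l)"
    using u(1) v(1)
  proof eventually_elim
    case (elim l)
    have "(\<lambda>(x, y). f x y) \<circ> (\<lambda>l. (u l, v l)) differentiable (at l)"
      using pair[OF elim] f by (intro differentiable_chain_at) auto
    then show ?case by (simp add: o_def)
  qed
  obtain D where D: "((\<lambda>(x, y). f x y) has_derivative D) (at (x, y))"
    using f unfolding differentiable_def by blast
  then interpret D: bounded_linear D by (rule has_derivative_bounded_linear)
  have Dh: "D (s, t) = s * D (1, 0) + t * D (0, 1)" for s t
    using D.add[of "(s, 0)" "(0, t)"] D.scaleR[of s "(1, 0)"] D.scaleR[of t "(0, 1)"] by simp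
  have D1: "(\<lambda>h. D (h, 0)) = (*) (D (1, 0))" and D2: "(\<lambda>h. D (0, h)) = (*) (D (0, 1))"
    by (rule ext, subst Dh, simp)+
  have Df: "((\<lambda>p. case p of (x, y) \<Rightarrow> f x y) has_derivative D) (at (x, y))" using D .
  have "((\<lambda>s. (s, y)) has_derivative (\<lambda>h. (h, 0))) (at x)"
    by (auto intro!: derivative_eq_intros)
  from has_derivative_compose[OF this Df] have "((\<lambda>s. f s y) has_real_derivative D (1, 0)) (at x)"
    unfolding has_field_derivative_def
    by (simp add: D1)
  then have fx: "partial_fst f x y = D (1, 0)" by (simp add: partial_fst_def DERIV_imp_deriv)
  have "((\<lambda>t. (x, t)) has_derivative (\<lambda>h. (0, h))) (at y)"
    by (auto intro!: derivative_eq_intros)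
  from has_derivative_compose[OF this Df] have "((\<lambda>t. f x t) has_real_derivative D (0, 1)) (at y)"
    unfolding has_field_derivative_def
    by (simp add: D2)
  then have fy: "partial_snd f x y = D (0, 1)" by (simp add: partial_snd_def DERIV_imp_deriv)
  have "((\<lambda>l. (u l, v l)) has_derivative (\<lambda>h. (- u' * h, - v' * h))) (at b)"
    using u(2) v(2) unfolding has_field_derivative_def by (rule has_derivative_Pair)
  from has_derivative_compose[OF this, of "\<lambda>(x, y). f x y" D] u(3) v(3) Df
  have "((\<lambda>l. f (u l) (v l)) has_derivative (\<lambda>h. D (- u' * h, - v' * h))) (at b)" by simp
  then show "((\<lambda>l. f (u l) (v l)) has_real_derivative
      (- partial_fst f x y * u' - partial_snd f x y * v')) (at b)"
    unfolding has_field_derivative_def fx fy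
    by (rule has_derivative_eq_rhs) (rule ext, subst Dh, simp add: algebra_simps)
qed

section \<open>Monotone factors\<close>

lemma abs_sin_less: "\<bar>sin x\<bar> < x" if pos: "0 < x" for x :: real
proof (cases "x > 1")
  case True
  then show ?thesis using abs_sin_le_one[of x] by linarith
next
  case False
  obtain z where z: "0 < z" "z < x" "sin x - sin 0 = (x - 0) * cos z"
    using MVT2[OF pos, of sin cos] DERIV_sin by blast
  have "cos z < 1"
    using cos_monotone_0_pi[of 0 z] z False pi_gt3 by simp
  moreover have "cos z > 0"
    using cos_gt_zero[of z] z False pi_gt3 by simp
  ultimately show ?thesis using z pos by (simp add: abs_mult)
qed

text \<open>With \<open>u = l z\<close>, the derivatives of \<open>z tan (l z)\<close> and \<open>tan (l z) / z\<close> in \<open>z\<close> are positive multiples of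
  \<open>u + sin u cos u\<close> and \<open>u - sin u cos u\<close>.\<close>

lemma abs_sin_mult_cos_less: "\<bar>sin x * cos x\<bar> < x" if "0 < x" for x :: real
  using abs_sin_less[of "2 * x"] that by (simp add: sin_double abs_mult)

text \<open>This inequality makes \<open>tanh (l z) / z\<close> decrease.\<close>

lemma mult_sech_square_less_tanh: "x * (1 - (tanh x)\<^sup>2) < tanh x" if "0 < x" for x :: real
proof -
  let ?D = "\<lambda>x::real. tanh x - x * (1 - (tanh x)\<^sup>2)"
  have "?D 0 < ?D x"
  proof (rule DERIV_pos_imp_increasing_open[OF that])
    fix y :: real assume "0 < y" "y < x"
    moreover have "(tanh y)\<^sup>2 < 1"
      using tanh_real_bounds[of y] by (simp add: abs_square_less_1 abs_less_iff)
    ultimately have "2 * y * tanh y * (1 - (tanh y)\<^sup>2) > 0" by simp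
    then show "\<exists>d. (?D has_real_derivative d) (at y) \<and> 0 < d"
      by (intro exI[of _ "2 * y * tanh y * (1 - (tanh y)\<^sup>2)"])
         (auto intro!: derivative_eq_intros simp: algebra_simps)
  qed (auto intro!: continuous_intros)
  then show ?thesis by simp
qed

lemma has_real_derivative_comp_sqrt:
  assumes "x > 0" "(phi has_real_derivative d) (at (sqrt x))"
  shows "((\<lambda>x. phi (sqrt x)) has_real_derivative d / (2 * sqrt x)) (at x)"
  using DERIV_chain2[OF assms(2) DERIV_real_sqrt[OF assms(1)]]
  by (simp add: field_simps)

text \<open>With \<open>s = sqrt lam\<close> and \<open>N = m\<^sup>2\<close>, the eigenvalue equations involve the following functions
  at the points \<open>s + N\<close>, \<open>s - N\<close> and \<open>N - s\<close>: \<open>z tanh (l z)\<close>, \<open>tanh (l z) / z\<close>, \<open>z tan (l z)\<close> and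
  \<open>tan (l z) / z\<close> as functions of \<open>x = z\<^sup>2\<close>, and the squared quotient \<open>rho\<close> of the polynomial factors,
  in which \<open>c\<close> stands for \<open>(1 - sigma) m\<^sup>2\<close>.\<close>

definition x_tanh :: "real \<Rightarrow> real \<Rightarrow> real" where
  "x_tanh l x = sqrt x * tanh (l * sqrt x)"

definition tanh_over :: "real \<Rightarrow> real \<Rightarrow> real" where
  "tanh_over l x = tanh (l * sqrt x) / sqrt x"

definition x_tan :: "real \<Rightarrow> real \<Rightarrow> real" where
  "x_tan l x = sqrt x * tan (l * sqrt x)"

definition tan_over :: "real \<Rightarrow> real \<Rightarrow> real" where
  "tan_over l x = tan (l * sqrt x) / sqrt x"

definition rho :: "real \<Rightarrow> real \<Rightarrow> real" where
  "rho c s = ((s + c) / (s - c))\<^sup>2"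

lemma x_tanh_pos: "l > 0 \<Longrightarrow> x > 0 \<Longrightarrow> x_tanh l x > 0"
  by (simp add: x_tanh_def)

lemma tanh_over_pos: "l > 0 \<Longrightarrow> x > 0 \<Longrightarrow> tanh_over l x > 0"
  by (simp add: tanh_over_def)

lemma rho_pos: "0 < c \<Longrightarrow> c < s \<Longrightarrow> rho c s > 0"
  by (simp add: rho_def)

lemma x_tanh_deriv:
  assumes "l > 0" "x > 0"
  shows "\<exists>d>0. (x_tanh l has_real_derivative d) (at x)"
proof -
  define y where "y = sqrt x"
  have y: "y > 0" using assms by (simp add: y_def)
  let ?d = "tanh (l * y) + y * l * (1 - (tanh (l * y))\<^sup>2)"
  have "((\<lambda>y. y * tanh (l * y)) has_real_derivative ?d) (at (sqrt x))"
    by (auto intro!: derivative_eq_intros simp: y_def algebra_simps)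
  from has_real_derivative_comp_sqrt[OF assms(2) this]
  have "(x_tanh l has_real_derivative ?d / (2 * sqrt x)) (at x)"
    by (simp add: x_tanh_def[abs_def])
  moreover have "(tanh (l * y))\<^sup>2 < 1"
    using tanh_real_bounds[of "l * y"] by (simp add: abs_square_less_1 abs_less_iff)
  then have "?d > 0" using assms y by (intro add_pos_pos mult_pos_pos) auto
  ultimately show ?thesis using assms by (intro exI[of _ "?d / (2 * sqrt x)"]) simp
qed

lemma tanh_over_deriv:
  assumes "l > 0" "x > 0"
  shows "\<exists>d<0. (tanh_over l has_real_derivative d) (at x)"
proof -
  define y where "y = sqrt x"
  have y: "y > 0" using assms by (simp add: y_def)
  let ?d = "(l * y * (1 - (tanh (l * y))\<^sup>2) - tanh (l * y)) / y\<^sup>2"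
  have "((\<lambda>y. tanh (l * y) / y) has_real_derivative ?d) (at (sqrt x))"
    using assms by (auto intro!: derivative_eq_intros simp: y_def algebra_simps power2_eq_square)
  from has_real_derivative_comp_sqrt[OF assms(2) this]
  have "(tanh_over l has_real_derivative ?d / (2 * sqrt x)) (at x)"
    by (simp add: tanh_over_def[abs_def])
  moreover have "?d < 0"
    using mult_sech_square_less_tanh[of "l * y"] assms y by (simp add: divide_less_0_iff)
  ultimately show ?thesis
    using assms by (intro exI[of _ "?d / (2 * sqrt x)"]) (simp add: divide_less_0_iff)
qed

lemma x_tan_deriv:
  assumes "l > 0" "x > 0" and c: "cos (l * sqrt x) \<noteq> 0"
  shows "\<exists>d>0. (x_tan l has_real_derivative d) (at x)"
proof -
  define y where "y = sqrt x"
  have y: "y > 0" using assms by (simp add: y_def)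
  let ?d = "(sin (l * y) * cos (l * y) + l * y) / (cos (l * y))\<^sup>2"
  have c': "cos (l * y) \<noteq> 0" using c by (simp add: y_def)
  have "((\<lambda>y. y * tan (l * y)) has_real_derivative tan (l * y) + y * (inverse ((cos (l * y))\<^sup>2) * l)) (at y)"
    using c' by (auto intro!: derivative_eq_intros)
  also have "tan (l * y) + y * (inverse ((cos (l * y))\<^sup>2) * l) = ?d"
    using c' by (simp add: tan_def field_simps power2_eq_square)
  finally have "((\<lambda>y. y * tan (l * y)) has_real_derivative ?d) (at (sqrt x))"
    unfolding y_def .
  from has_real_derivative_comp_sqrt[OF assms(2) this]
  have "(x_tan l has_real_derivative ?d / (2 * sqrt x)) (at x)"
    by (simp add: x_tan_def[abs_def])
  moreover have "?d > 0"
    using abs_sin_mult_cos_less[of "l * y"] assms(1) y c' by (intro divide_pos_pos) auto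
  ultimately show ?thesis
    using assms(2) by (intro exI[of _ "?d / (2 * sqrt x)"]) (simp del: divide_divide_eq_left)
qed

lemma tan_over_deriv:
  assumes "l > 0" "x > 0" and c: "cos (l * sqrt x) \<noteq> 0"
  shows "\<exists>d>0. (tan_over l has_real_derivative d) (at x)"
proof -
  define y where "y = sqrt x"
  have y: "y > 0" using assms by (simp add: y_def)
  let ?d = "(l * y - sin (l * y) * cos (l * y)) / ((cos (l * y))\<^sup>2 * y\<^sup>2)"
  have c': "cos (l * y) \<noteq> 0" using c by (simp add: y_def)
  have "((\<lambda>y. tan (l * y) / y) has_real_derivative
      (inverse ((cos (l * y))\<^sup>2) * l * y - tan (l * y)) / y\<^sup>2) (at y)"
    using c' y by (auto intro!: derivative_eq_intros simp: power2_eq_square)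
  also have "(inverse ((cos (l * y))\<^sup>2) * l * y - tan (l * y)) / y\<^sup>2 = ?d"
    using c' y by (simp add: tan_def field_simps power2_eq_square)
  finally have "((\<lambda>y. tan (l * y) / y) has_real_derivative ?d) (at (sqrt x))"
    unfolding y_def .
  from has_real_derivative_comp_sqrt[OF assms(2) this]
  have "(tan_over l has_real_derivative ?d / (2 * sqrt x)) (at x)"
    by (simp add: tan_over_def[abs_def])
  moreover have "?d > 0"
    using abs_sin_mult_cos_less[of "l * y"] assms(1) y c' by (intro divide_pos_pos) auto
  ultimately show ?thesis
    using assms(2) by (intro exI[of _ "?d / (2 * sqrt x)"]) (simp del: divide_divide_eq_left)
qed

lemma rho_deriv:
  assumes "0 < c" "c < s"
  shows "\<exists>d<0. (rho c has_real_derivative d) (at s)"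
proof -
  let ?d = "2 * ((s + c) / (s - c)) * ((s - c - (s + c)) / (s - c)\<^sup>2)"
  have "((\<lambda>s. (s + c) / (s - c)) has_real_derivative (s - c - (s + c)) / (s - c)\<^sup>2) (at s)"
    using assms by (auto intro!: derivative_eq_intros simp: power2_eq_square)
  from DERIV_power[OF this, of 2] have "(rho c has_real_derivative ?d) (at s)"
    unfolding rho_def[abs_def] by (simp add: mult_ac)
  moreover have "?d < 0"
    using assms by (intro mult_pos_neg mult_pos_pos divide_neg_pos divide_pos_pos) auto
  ultimately show ?thesis by blast
qed

lemma deriv_reflect:
  assumes "(phi has_real_derivative d) (at (N - s))"
  shows "((\<lambda>s. phi (N - s)) has_real_derivative - d) (at s)"
proof -
  have "((\<lambda>s. N - s) has_real_derivative - 1) (at s)" by (auto intro!: derivative_eq_intros)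
  from DERIV_chain2[where f = phi and g = "\<lambda>s. N - s", OF assms this] show ?thesis by simp
qed

lemma deriv_shift:
  assumes "(phi has_real_derivative d) (at (s + N))"
  shows "((\<lambda>s. phi (s + N)) has_real_derivative d) (at s)"
proof -
  have "((\<lambda>s. s + N) has_real_derivative 1) (at s)" by (auto intro!: derivative_eq_intros)
  from DERIV_chain2[where f = phi and g = "\<lambda>s. s + N", OF assms this] show ?thesis by simp
qed

lemma deriv_shift_minus:
  assumes "(phi has_real_derivative d) (at (s - N))"
  shows "((\<lambda>s. phi (s - N)) has_real_derivative d) (at s)"
  using deriv_shift[of phi d s "-N"] assms by simp

section \<open>Reduced eigenvalue functions\<close>

text \<open>The functions \<open>Phi\<close>, \<open>Upsilon\<close>, \<open>Psi\<close>, \<open>Gamma_fun\<close> as functions of \<open>s = sqrt lam\<close>, divided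
  by a factor that does not vanish for the \<open>s > c\<close> considered. Near their zeros all terms of a
  reduced function vary in the same direction, so that its derivative has a known sign.\<close>

definition Phi_reduced :: "real \<Rightarrow> real \<Rightarrow> real \<Rightarrow> real \<Rightarrow> real" where
  "Phi_reduced l c N s = rho c s * x_tanh l (N - s) - x_tanh l (s + N)"

definition Upsilon_reduced :: "real \<Rightarrow> real \<Rightarrow> real \<Rightarrow> real \<Rightarrow> real" where
  "Upsilon_reduced l c N s = rho c s * x_tan l (s - N) + x_tanh l (s + N)"

definition Psi_reduced :: "real \<Rightarrow> real \<Rightarrow> real \<Rightarrow> real \<Rightarrow> real" where
  "Psi_reduced l c N s = rho c s * tanh_over l (s + N) - tan_over l (s - N)"

definition Gamma_reduced :: "real \<Rightarrow> real \<Rightarrow> real \<Rightarrow> real \<Rightarrow> real" where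
  "Gamma_reduced l c N s = rho c s * tanh_over l (s + N) - tanh_over l (N - s)"

lemma Phi_reduced_deriv:
  assumes "l > 0" "0 < c" "c < s" "s < N"
  shows "\<exists>d<0. (Phi_reduced l c N has_real_derivative d) (at s)"
proof -
  obtain r where r: "r < 0" "(rho c has_real_derivative r) (at s)"
    using rho_deriv assms by blast
  obtain p where p: "p > 0" "(x_tanh l has_real_derivative p) (at (N - s))"
    using x_tanh_deriv[of l "N - s"] assms by auto
  obtain q where q: "q > 0" "(x_tanh l has_real_derivative q) (at (s + N))"
    using x_tanh_deriv[of l "s + N"] assms by auto
  have "(Phi_reduced l c N has_real_derivative r * x_tanh l (N - s) + (- p) * rho c s - q) (at s)"
    unfolding Phi_reduced_def[abs_def]
    by (intro DERIV_diff DERIV_mult r deriv_reflect deriv_shift p q)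
  moreover have "r * x_tanh l (N - s) < 0" "(- p) * rho c s < 0"
    using r p x_tanh_pos[of l "N - s"] rho_pos[of c s] assms by (simp_all add: mult_neg_pos)
  then have "r * x_tanh l (N - s) + (- p) * rho c s - q < 0" using q(1) by linarith
  ultimately show ?thesis by blast
qed

lemma Gamma_reduced_deriv:
  assumes "l > 0" "0 < c" "c < s" "s < N"
  shows "\<exists>d<0. (Gamma_reduced l c N has_real_derivative d) (at s)"
proof -
  obtain r where r: "r < 0" "(rho c has_real_derivative r) (at s)"
    using rho_deriv assms by blast
  obtain p where p: "p < 0" "(tanh_over l has_real_derivative p) (at (s + N))"
    using tanh_over_deriv[of l "s + N"] assms by auto
  obtain q where q: "q < 0" "(tanh_over l has_real_derivative q) (at (N - s))"
    using tanh_over_deriv[of l "N - s"] assms by auto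
  have "(Gamma_reduced l c N has_real_derivative r * tanh_over l (s + N) + p * rho c s - (- q)) (at s)"
    unfolding Gamma_reduced_def[abs_def]
    by (intro DERIV_diff DERIV_mult r deriv_reflect deriv_shift p q)
  moreover have "r * tanh_over l (s + N) < 0" "p * rho c s < 0"
    using r p tanh_over_pos[of l "s + N"] rho_pos[of c s] assms by (simp_all add: mult_neg_pos)
  then have "r * tanh_over l (s + N) + p * rho c s - (- q) < 0" using q(1) by linarith
  ultimately show ?thesis by blast
qed

lemma Psi_reduced_deriv:
  assumes "l > 0" "0 < c" "c < N" "N < s" "cos (l * sqrt (s - N)) \<noteq> 0"
  shows "\<exists>d<0. (Psi_reduced l c N has_real_derivative d) (at s)"
proof -
  obtain r where r: "r < 0" "(rho c has_real_derivative r) (at s)"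
    using rho_deriv[of c s] assms by auto
  obtain p where p: "p < 0" "(tanh_over l has_real_derivative p) (at (s + N))"
    using tanh_over_deriv[of l "s + N"] assms by auto
  obtain q where q: "q > 0" "(tan_over l has_real_derivative q) (at (s - N))"
    using tan_over_deriv[of l "s - N"] assms by auto
  have "(Psi_reduced l c N has_real_derivative r * tanh_over l (s + N) + p * rho c s - q) (at s)"
    unfolding Psi_reduced_def[abs_def]
    by (intro DERIV_diff DERIV_mult r deriv_shift_minus deriv_shift p q)
  moreover have "r * tanh_over l (s + N) < 0" "p * rho c s < 0"
    using r p tanh_over_pos[of l "s + N"] rho_pos[of c s] assms by (simp_all add: mult_neg_pos)
  then have "r * tanh_over l (s + N) + p * rho c s - q < 0" using q(1) by linarith
  ultimately show ?thesis by blast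
qed

text \<open>Where the tangent is negative, both the decrease of \<open>rho\<close> and the increase of \<open>x_tan\<close> make
  \<open>rho c s * x_tan l (s - N)\<close> increase.
  Other points are not needed, because \<open>Upsilon\<close> has no zero where the tangent is nonnegative.\<close>

lemma Upsilon_reduced_deriv:
  assumes "l > 0" "0 < c" "c < N" "N < s" "cos (l * sqrt (s - N)) \<noteq> 0" "tan (l * sqrt (s - N)) < 0"
  shows "\<exists>d>0. (Upsilon_reduced l c N has_real_derivative d) (at s)"
proof -
  obtain r where r: "r < 0" "(rho c has_real_derivative r) (at s)"
    using rho_deriv[of c s] assms by auto
  obtain p where p: "p > 0" "(x_tan l has_real_derivative p) (at (s - N))"
    using x_tan_deriv[of l "s - N"] assms by auto
  obtain q where q: "q > 0" "(x_tanh l has_real_derivative q) (at (s + N))"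
    using x_tanh_deriv[of l "s + N"] assms by auto
  have "(Upsilon_reduced l c N has_real_derivative r * x_tan l (s - N) + p * rho c s + q) (at s)"
    unfolding Upsilon_reduced_def[abs_def]
    by (intro DERIV_add DERIV_mult r deriv_shift_minus deriv_shift p q)
  moreover have "x_tan l (s - N) < 0" using assms by (simp add: x_tan_def mult_pos_neg)
  then have "r * x_tan l (s - N) > 0" "p * rho c s > 0"
    using r p rho_pos[of c s] assms by (simp_all add: mult_neg_neg)
  then have "r * x_tan l (s - N) + p * rho c s + q > 0" using q(1) by linarith
  ultimately show ?thesis by blast
qed

lemma Phi_factor:
  assumes "sqrt lam \<noteq> (1 - sigma) * (real m)\<^sup>2"
  shows "Phi m lam l = (sqrt lam - (1 - sigma) * (real m)\<^sup>2)\<^sup>2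
    * Phi_reduced l ((1 - sigma) * (real m)\<^sup>2) ((real m)\<^sup>2) (sqrt lam)"
proof -
  define s N c where "s = sqrt lam" and "N = (real m)\<^sup>2" and "c = (1 - sigma) * N"
  have *: "(s + c)\<^sup>2 = (s - c)\<^sup>2 * rho c s"
    using assms by (simp add: rho_def s_def c_def N_def power_divide)
  then show ?thesis
    unfolding Phi_def Phi_reduced_def x_tanh_def s_def[symmetric] N_def[symmetric] c_def[symmetric] *
    by (simp add: algebra_simps)
qed

lemma Upsilon_factor:
  assumes "sqrt lam \<noteq> (1 - sigma) * (real m)\<^sup>2"
  shows "Upsilon m lam l = (sqrt lam - (1 - sigma) * (real m)\<^sup>2)\<^sup>2
    * Upsilon_reduced l ((1 - sigma) * (real m)\<^sup>2) ((real m)\<^sup>2) (sqrt lam)"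
proof -
  define s N c where "s = sqrt lam" and "N = (real m)\<^sup>2" and "c = (1 - sigma) * N"
  have *: "(s + c)\<^sup>2 = (s - c)\<^sup>2 * rho c s"
    using assms by (simp add: rho_def s_def c_def N_def power_divide)
  then show ?thesis
    unfolding Upsilon_def Upsilon_reduced_def x_tanh_def x_tan_def s_def[symmetric] N_def[symmetric] c_def[symmetric] *
    by (simp add: algebra_simps)
qed

lemma factor_out_sqrt_quotients:
  "y * (q * r) * t - z * q * u = y * z * q * (r * (t / z) - u / y)"
  if "y \<noteq> 0" "z \<noteq> 0" for y z q r t u :: real
  using that by (simp add: field_simps)

lemma Psi_factor:
  assumes "sqrt lam \<noteq> (1 - sigma) * (real n)\<^sup>2" "(real n)\<^sup>2 < sqrt lam"
  shows "Psi n lam l = sqrt (sqrt lam - (real n)\<^sup>2) * sqrt (sqrt lam + (real n)\<^sup>2)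
      * (sqrt lam - (1 - sigma) * (real n)\<^sup>2)\<^sup>2
    * Psi_reduced l ((1 - sigma) * (real n)\<^sup>2) ((real n)\<^sup>2) (sqrt lam)"
proof -
  define s N c where "s = sqrt lam" and "N = (real n)\<^sup>2" and "c = (1 - sigma) * N"
  have *: "(s + c)\<^sup>2 = (s - c)\<^sup>2 * rho c s"
    using assms by (simp add: rho_def s_def c_def N_def power_divide)
  have "N \<ge> 0" "N < s" using assms by (simp_all add: N_def s_def)
  then have "sqrt (s - N) > 0" "sqrt (s + N) > 0" by simp_all
  then show ?thesis
    unfolding Psi_def Psi_reduced_def tanh_over_def tan_over_def s_def[symmetric] N_def[symmetric] c_def[symmetric] *
    by (intro factor_out_sqrt_quotients) simp_all
qed

lemma Gamma_factor:
  assumes "sqrt lam \<noteq> (1 - sigma) * (real n)\<^sup>2" "0 < sqrt lam" "sqrt lam < (real n)\<^sup>2"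
  shows "Gamma_fun n lam l = sqrt ((real n)\<^sup>2 - sqrt lam) * sqrt (sqrt lam + (real n)\<^sup>2)
      * (sqrt lam - (1 - sigma) * (real n)\<^sup>2)\<^sup>2
    * Gamma_reduced l ((1 - sigma) * (real n)\<^sup>2) ((real n)\<^sup>2) (sqrt lam)"
proof -
  define s N c where "s = sqrt lam" and "N = (real n)\<^sup>2" and "c = (1 - sigma) * N"
  have *: "(s + c)\<^sup>2 = (s - c)\<^sup>2 * rho c s"
    using assms by (simp add: rho_def s_def c_def N_def power_divide)
  have "0 < s" "s < N" using assms by (simp_all add: N_def s_def)
  then have "sqrt (N - s) > 0" "sqrt (s + N) > 0" by simp_all
  then show ?thesis
    unfolding Gamma_fun_def Gamma_reduced_def tanh_over_def s_def[symmetric] N_def[symmetric] c_def[symmetric] *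
    by (intro factor_out_sqrt_quotients) simp_all
qed

text \<open>At a zero of \<open>H\<close> continuity of \<open>Q\<close> is enough for the product rule.\<close>

lemma has_real_derivative_mult_at_zero:
  fixes Q H :: "real \<Rightarrow> real"
  assumes "isCont Q a" "(H has_real_derivative d) (at a)" "H a = 0"
  shows "((\<lambda>x. Q x * H x) has_real_derivative Q a * d) (at a)"
proof -
  obtain g where g: "\<forall>z. H z - H a = g z * (z - a)" "isCont g a" "g a = d"
    using assms(2) CARAT_DERIV by metis
  show ?thesis
    by (subst CARAT_DERIV, rule exI[of _ "\<lambda>x. Q x * g x"]) (use g assms in auto)
qed

lemma deriv_nonzero_of_factor:
  fixes F Q H :: "real \<Rightarrow> real"
  assumes "lam > 0" "\<forall>\<^sub>F x in nhds lam. F x = Q (sqrt x) * H (sqrt x)"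
    and "isCont Q (sqrt lam)" "Q (sqrt lam) \<noteq> 0"
    and "(H has_real_derivative d) (at (sqrt lam))" "d \<noteq> 0"
    and "F lam = 0"
  shows "deriv F lam \<noteq> 0"
proof -
  have "F lam = Q (sqrt lam) * H (sqrt lam)"
    using assms(2) by (rule eventually_nhds_x_imp_x)
  then have H0: "H (sqrt lam) = 0" using assms by simp
  have "((\<lambda>x. Q (sqrt x) * H (sqrt x)) has_real_derivative Q (sqrt lam) * d / (2 * sqrt lam)) (at lam)"
    using has_real_derivative_comp_sqrt[OF assms(1) has_real_derivative_mult_at_zero[OF assms(3,5) H0]] .
  then have "(F has_real_derivative Q (sqrt lam) * d / (2 * sqrt lam)) (at lam)"
    using DERIV_cong_ev[OF refl assms(2) refl] by blast
  then show ?thesis using assms by (simp add: DERIV_imp_deriv)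
qed

section \<open>Zeros of \<open>Phi\<close> and \<open>Gamma_fun\<close> below \<open>m^4\<close>\<close>

lemma no_two_zeros_if_deriv_neg:
  fixes H :: "real \<Rightarrow> real"
  assumes "\<And>w. u \<le> w \<Longrightarrow> w \<le> v \<Longrightarrow> \<exists>d<0. (H has_real_derivative d) (at w)"
    and "H u = 0" "H v = 0"
  shows "\<not> u < v"
  using DERIV_neg_imp_decreasing[of u v H] assms by force

lemma no_two_zeros_if_deriv_pos:
  fixes H :: "real \<Rightarrow> real"
  assumes "\<And>w. u \<le> w \<Longrightarrow> w \<le> v \<Longrightarrow> \<exists>d>0. (H has_real_derivative d) (at w)"
    and "H u = 0" "H v = 0"
  shows "\<not> u < v"
  using DERIV_pos_imp_increasing[of u v H] assms by force

lemma one_minus_sigma: "1 - sigma = 4 / 5"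
  by (simp add: sigma_def)

text \<open>Since \<open>(1 - sigma)\<^sup>2 < 1 - sigma\<^sup>2\<close>, the window for \<open>lam\<close> keeps \<open>sqrt lam\<close> to the right of the
  zero \<open>(1 - sigma) m\<^sup>2\<close> of the polynomial factor.\<close>

lemma sqrt_window:
  assumes "m \<ge> 1" "(1 - sigma^2) * real m ^ 4 \<le> lam" "lam < real m ^ 4"
  shows "0 < lam" "0 < (1 - sigma) * (real m)\<^sup>2" "(1 - sigma) * (real m)\<^sup>2 < sqrt lam" "sqrt lam < (real m)\<^sup>2"
proof -
  have m: "real m ^ 4 > 0" using assms(1) by simp
  then have *: "((1 - sigma) * (real m)\<^sup>2)\<^sup>2 < (1 - sigma^2) * real m ^ 4"
    by (simp add: sigma_def power_mult_distrib power2_eq_square power4_eq_xxxx)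
  also note assms(2)
  finally have lo: "((1 - sigma) * (real m)\<^sup>2)\<^sup>2 < lam" .
  show "0 < lam" using lo zero_le_power2 by (rule le_less_trans[rotated])
  show "0 < (1 - sigma) * (real m)\<^sup>2" using assms(1) by (simp add: sigma_def)
  show "(1 - sigma) * (real m)\<^sup>2 < sqrt lam" using lo by (rule real_less_rsqrt)
  show "sqrt lam < (real m)\<^sup>2"
    using assms(3) by (intro real_less_lsqrt) (simp_all add: power2_eq_square power4_eq_xxxx mult.assoc)
qed

lemma sqrt_above:
  assumes "real m ^ 4 < lam"
  shows "(real m)\<^sup>2 < sqrt lam"
  using assms by (intro real_less_rsqrt) (simp add: power2_eq_square power4_eq_xxxx mult.assoc)

text \<open>The lower end \<open>(1 - sigma\<^sup>2) m^4\<close> is the point where the two algebraic coefficients balance,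
  \<open>(s + c)\<^sup>2 (N - s) = (s - c)\<^sup>2 (s + N)\<close>, so there the sign of \<open>Phi\<close> is decided by the decrease of
  \<open>tanh (l z) / z\<close>.\<close>

lemma Phi_ex1_root:
  assumes "m \<ge> 1" "l > 0"
  shows "\<exists>!x. root_between (\<lambda>lam. Phi m lam l) ((1 - sigma^2) * real m ^ 4) (real m ^ 4) x"
proof (rule ex_ex1I)
  define N c where "N = (real m)\<^sup>2" and "c = (1 - sigma) * N"
  let ?lo = "(1 - sigma^2) * real m ^ 4" and ?hi = "real m ^ 4"
  have N: "N > 0" using assms by (simp add: N_def)
  have hi: "?hi = N\<^sup>2" by (simp add: N_def)
  have lohi: "?lo < ?hi" using assms by (simp add: sigma_def)
  have "Phi m ?hi l = - (sqrt (2 * N) * (N - c)\<^sup>2 * tanh (l * sqrt (2 * N)))"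
    unfolding Phi_def hi using N by (simp add: N_def[symmetric] c_def)
  also have "\<dots> < 0" using N assms by (simp add: c_def sigma_def)
  finally have neg: "Phi m ?hi l < 0" .
  define s where "s = sqrt ?lo"
  have w: "0 < c" "c < s" "s < N"
    using sqrt_window[of m ?lo] assms lohi by (simp_all add: s_def c_def N_def)
  have "s\<^sup>2 = ?lo" unfolding s_def by (rule real_sqrt_pow2) (simp add: sigma_def power2_eq_square)
  then have s2: "s\<^sup>2 = (1 - sigma^2) * N\<^sup>2" by (simp add: N_def)
  have "(s + c)\<^sup>2 * (N - s) - (s - c)\<^sup>2 * (s + N) = 2 * s * ((1 - sigma^2) * N\<^sup>2 - s\<^sup>2)"
    by (simp add: c_def power2_eq_square algebra_simps)
  then have bal: "(s + c)\<^sup>2 * (N - s) = (s - c)\<^sup>2 * (s + N)" using s2 by simp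
  have "rho c s * (N - s) = s + N"
    using bal w by (simp add: rho_def power_divide field_simps)
  have x: "x_tanh l x = x * tanh_over l x" if "x > 0" for x
  proof -
    have "x * tanh_over l x = (x / sqrt x) * tanh (l * sqrt x)" by (simp add: tanh_over_def)
    then show ?thesis using real_div_sqrt[of x] that by (simp add: x_tanh_def)
  qed
  have "Phi_reduced l c N s = (rho c s * (N - s)) * tanh_over l (N - s) - (s + N) * tanh_over l (s + N)"
    unfolding Phi_reduced_def using w by (simp add: x mult.assoc)
  also have "\<dots> = (s + N) * (tanh_over l (N - s) - tanh_over l (s + N))"
    unfolding \<open>rho c s * (N - s) = s + N\<close> by (simp add: right_diff_distrib)
  finally have "Phi_reduced l c N s = (s + N) * (tanh_over l (N - s) - tanh_over l (s + N))" .
  moreover have "tanh_over l (s + N) < tanh_over l (N - s)"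
  proof (rule DERIV_neg_imp_decreasing[where f = "tanh_over l"])
    fix x assume "N - s \<le> x"
    then have "x > 0" using w by linarith
    from tanh_over_deriv[OF assms(2) this]
    show "\<exists>y. (tanh_over l has_real_derivative y) (at x) \<and> y < 0" by blast
  qed (use w in simp)
  ultimately have "Phi_reduced l c N s > 0" using w by simp
  then have pos: "Phi m ?lo l > 0"
    using Phi_factor[of ?lo m l] w by (simp add: s_def c_def N_def)
  have "continuous_on {?lo..?hi} (\<lambda>lam. Phi m lam l)"
    unfolding Phi_def by (intro continuous_intros) (auto simp: cosh_real_nonzero)
  then obtain x where x: "?lo \<le> x" "x \<le> ?hi" "Phi m x l = 0"
    using IVT2'[of "\<lambda>lam. Phi m lam l" ?hi 0 ?lo] neg pos lohi by force
  then have "root_between (\<lambda>lam. Phi m lam l) ?lo ?hi x"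
    using neg pos unfolding root_between_def by (metis less_irrefl order_le_less)
  then show "\<exists>x. root_between (\<lambda>lam. Phi m lam l) ?lo ?hi x" ..
  fix x y
  assume *: "root_between (\<lambda>lam. Phi m lam l) ?lo ?hi x" "root_between (\<lambda>lam. Phi m lam l) ?lo ?hi y"
  have red: "0 < c \<and> c < sqrt z \<and> sqrt z < N \<and> Phi_reduced l c N (sqrt z) = 0"
    if "root_between (\<lambda>lam. Phi m lam l) ?lo ?hi z" for z
    using that sqrt_window[of m z] assms Phi_factor[of z m l]
    by (auto simp: root_between_def c_def N_def)
  have "\<not> sqrt u < sqrt v"
    if "root_between (\<lambda>lam. Phi m lam l) ?lo ?hi u" "root_between (\<lambda>lam. Phi m lam l) ?lo ?hi v" for u v
    using red[OF that(1)] red[OF that(2)] assms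
    by (intro no_two_zeros_if_deriv_neg[of _ _ "Phi_reduced l c N"] Phi_reduced_deriv) auto
  from this[OF *] this[OF *(2,1)] show "x = y" by simp
qed

lemma Gamma_root_unique:
  assumes "n \<ge> 1" "l > 0"
    and "root_between (\<lambda>lam. Gamma_fun n lam l) ((1 - sigma^2) * real n ^ 4) (real n ^ 4) x"
    and "root_between (\<lambda>lam. Gamma_fun n lam l) ((1 - sigma^2) * real n ^ 4) (real n ^ 4) y"
  shows "x = y"
proof -
  define N c where "N = (real n)\<^sup>2" and "c = (1 - sigma) * N"
  let ?R = "root_between (\<lambda>lam. Gamma_fun n lam l) ((1 - sigma^2) * real n ^ 4) (real n ^ 4)"
  have red: "0 < c \<and> c < sqrt z \<and> sqrt z < N \<and> Gamma_reduced l c N (sqrt z) = 0" if "?R z" for z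
    using that sqrt_window[of n z] assms Gamma_factor[of z n l]
    by (auto simp: root_between_def c_def N_def)
  have "\<not> sqrt u < sqrt v" if "?R u" "?R v" for u v
    using red[OF that(1)] red[OF that(2)] assms
    by (intro no_two_zeros_if_deriv_neg[of _ _ "Gamma_reduced l c N"] Gamma_reduced_deriv) auto
  from this[OF assms(3,4)] this[OF assms(4,3)] show "x = y" by simp
qed

section \<open>Numbering the zeros of \<open>Psi\<close> and \<open>Upsilon\<close> above \<open>m^4\<close>\<close>

text \<open>Zeros can be numbered in increasing order as soon as they are sorted into cells, each cell
  holding at most one zero and each cell of index at least \<open>1\<close> holding one. Whether cell \<open>0\<close>
  holds a zero is left open, so the \<open>k\<close>-th zero need not lie in cell \<open>k\<close>.\<close>

lemma nth_root_above_ex1: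
  fixes F :: "real \<Rightarrow> real" and cell :: "real \<Rightarrow> int" and a :: real
  defines "Z \<equiv> {y. a < y \<and> F y = 0}"
  assumes mono: "\<And>x y. x \<in> Z \<Longrightarrow> y \<in> Z \<Longrightarrow> x < y \<Longrightarrow> cell x \<le> cell y"
    and nonneg: "\<And>x. x \<in> Z \<Longrightarrow> 0 \<le> cell x"
    and inj: "\<And>x y. x \<in> Z \<Longrightarrow> y \<in> Z \<Longrightarrow> x < y \<Longrightarrow> cell x \<noteq> cell y"
    and surj: "\<And>i::nat. i \<ge> 1 \<Longrightarrow> \<exists>x\<in>Z. cell x = int i"
    and k: "k \<ge> 1"
  shows "\<exists>!x. nth_root_above F a k x"
proof -
  have fin: "finite {y\<in>Z. y < x}" if x: "x \<in> Z" for x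
  proof (rule inj_on_finite)
    show "inj_on cell {y\<in>Z. y < x}"
      using inj by (intro linorder_inj_onI') (metis (mono_tags, lifting) mem_Collect_eq)
    show "cell ` {y\<in>Z. y < x} \<subseteq> {0..cell x}" using mono nonneg x by auto
  qed simp
  have iff: "nth_root_above F a k x \<longleftrightarrow> x \<in> Z \<and> Suc (card {y\<in>Z. y < x}) = k" for k x
  proof -
    have "{y. a < y \<and> y < x \<and> F y = 0} = {y\<in>Z. y < x}" by (auto simp: Z_def)
    then show ?thesis using fin[of x] by (auto simp: nth_root_above_def Z_def)
  qed
  have next_root: "\<exists>y\<in>Z. x < y" if x: "x \<in> Z" for x
  proof -
    obtain y where y: "y \<in> Z" "cell y = int (nat (cell x) + 1)"
      using surj[of "nat (cell x) + 1"] by auto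
    then have "x < y" using mono[OF y(1) x] nonneg[OF x] by (cases x y rule: linorder_cases) auto
    with y show ?thesis by blast
  qed
  have first: "\<exists>y\<in>Z. P y \<and> (\<forall>z\<in>Z. P z \<longrightarrow> y \<le> z)" if "y0 \<in> Z" "P y0" for P y0
  proof -
    let ?A = "insert y0 {y\<in>Z. y < y0 \<and> P y}"
    have A: "finite ?A" using fin[OF that(1)] by (auto intro: finite_subset[rotated])
    have "Min ?A \<in> ?A" using A by (intro Min_in) auto
    moreover have "Min ?A \<le> z" if "z \<in> Z" "P z" for z
      using A that by (cases "z < y0") (auto simp: Min_le_iff)
    ultimately show ?thesis using that by (intro bexI[of _ "Min ?A"]) auto
  qed
  have ex: "\<exists>x\<in>Z. card {y\<in>Z. y < x} = j" for j
  proof (induction j)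
    case 0
    obtain y0 where "y0 \<in> Z" using surj[of 1] by auto
    from first[OF this, of "\<lambda>_. True"] obtain y where "y \<in> Z" "\<forall>z\<in>Z. y \<le> z" by auto
    then have "{z\<in>Z. z < y} = {}" by force
    then show ?case using \<open>y \<in> Z\<close> by (metis card.empty)
  next
    case (Suc j)
    then obtain x where x: "x \<in> Z" "card {y\<in>Z. y < x} = j" by blast
    obtain y0 where "y0 \<in> Z" "x < y0" using next_root[OF x(1)] by blast
    from first[of y0 "\<lambda>y. x < y", OF this] obtain y where y: "y \<in> Z" "x < y" "\<forall>z\<in>Z. x < z \<longrightarrow> y \<le> z" by auto
    then have "{z\<in>Z. z < y} = insert x {z\<in>Z. z < x}" using x(1) by force
    then have "card {z\<in>Z. z < y} = Suc j" using fin[OF x(1)] x(2) by simp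
    then show ?case using y(1) by blast
  qed
  have uniq: "\<not> x < y" if "nth_root_above F a k x" "nth_root_above F a k y" for x y
  proof
    assume "x < y"
    then have "{z\<in>Z. z < x} \<subset> {z\<in>Z. z < y}" using that iff by fastforce
    then have "card {z\<in>Z. z < x} < card {z\<in>Z. z < y}"
      using fin that iff by (intro psubset_card_mono) auto
    then show False using that iff by simp
  qed
  show ?thesis
  proof (rule ex_ex1I)
    show "\<exists>x. nth_root_above F a k x" using ex[of "k - 1"] k iff by auto
  qed (use uniq in \<open>metis linorder_neqE\<close>)
qed

text \<open>The argument of the tangent in \<open>Upsilon\<close> and \<open>Psi\<close>, with \<open>N = m\<^sup>2\<close>.\<close>

definition phase :: "real \<Rightarrow> real \<Rightarrow> real \<Rightarrow> real" where
  "phase l N lam = l * sqrt (sqrt lam - N)"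

text \<open>The number of the branch of the tangent that contains \<open>x\<close>: cell \<open>i\<close> is the interval from
  \<open>i * pi - pi / 2\<close> to \<open>i * pi + pi / 2\<close>, where the left end, a pole, belongs to the cell.\<close>

definition tan_cell :: "real \<Rightarrow> int" where "tan_cell x = \<lfloor>x / pi + 1 / 2\<rfloor>"

lemma tan_cell_mono: "x \<le> y \<Longrightarrow> tan_cell x \<le> tan_cell y"
  unfolding tan_cell_def by (intro floor_mono add_right_mono divide_right_mono) auto

lemma tan_cell_nonneg: "0 \<le> x \<Longrightarrow> 0 \<le> tan_cell x"
  using tan_cell_mono[of 0 x] by (simp add: tan_cell_def)

lemma tan_cell_eq:
  "tan_cell x = int i" if "real i * pi - pi / 2 \<le> x" "x < real i * pi + pi / 2"
  unfolding tan_cell_def using that by (intro floor_unique) (simp_all add: field_simps)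

lemma tan_cell_at_pole: "tan_cell (of_int j * pi + pi / 2) = j + 1"
proof -
  have "(of_int j * pi + pi / 2) / pi + 1 / 2 = of_int (j + 1)" by (simp add: add_divide_distrib)
  then show ?thesis unfolding tan_cell_def by (simp only: floor_of_int)
qed

lemma cos_nonzero_in_tan_cell:
  assumes "cos u \<noteq> 0" "cos v \<noteq> 0" "tan_cell u = tan_cell v" "u \<le> w" "w \<le> v"
  shows "cos w \<noteq> 0"
proof
  assume "cos w = 0"
  then obtain i :: int where w: "w = of_int i * pi + pi / 2" using cos_zero_iff_int2 by blast
  have "u < w" using assms \<open>cos w = 0\<close> by (cases "u = w") auto
  then have "u / pi + 1 / 2 < of_int (i + 1)" by (simp add: w field_simps)
  then have "tan_cell u < i + 1" unfolding tan_cell_def by (simp only: floor_less_iff)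
  moreover have "of_int (i + 1) \<le> v / pi + 1 / 2" using assms(5) by (simp add: w field_simps)
  then have "i + 1 \<le> tan_cell v" unfolding tan_cell_def by (simp only: le_floor_iff)
  ultimately show False using assms(3) by simp
qed

lemma tan_strict_mono_in_tan_cell:
  assumes "cos u \<noteq> 0" "cos v \<noteq> 0" "tan_cell u = tan_cell v" "u < v"
  shows "tan u < tan v"
  using assms(4)
proof (rule DERIV_pos_imp_increasing)
  fix w assume w: "u \<le> w" "w \<le> v"
  have "cos w \<noteq> 0" using cos_nonzero_in_tan_cell[OF assms(1-3) w] .
  then show "\<exists>d. (tan has_real_derivative d) (at w) \<and> 0 < d"
    by (intro exI[of _ "inverse ((cos w)\<^sup>2)"]) (auto intro: DERIV_tan)
qed

lemma phase_mono: "l > 0 \<Longrightarrow> x < y \<Longrightarrow> phase l N x < phase l N y"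
  by (simp add: phase_def)

text \<open>A zero of \<open>G\<close> strictly between two phases at which \<open>G\<close> has opposite signs; the factor \<open>e\<close>
  covers both orders of the signs.\<close>

lemma phase_crossing:
  assumes "l > 0" "N > 0" and G: "continuous_on UNIV G"
    and uv: "0 \<le> u" "u < v"
    and sgn: "\<And>x. phase l N x = u \<Longrightarrow> N\<^sup>2 \<le> x \<Longrightarrow> 0 < e * G x"
      "\<And>x. phase l N x = v \<Longrightarrow> N\<^sup>2 \<le> x \<Longrightarrow> e * G x < 0"
  shows "\<exists>z>N\<^sup>2. G z = (0::real) \<and> u < phase l N z \<and> phase l N z < v"
proof -
  \<comment> \<open>the inverse of the phase\<close>
  define x where "x u = ((u / l)\<^sup>2 + N)\<^sup>2" for u
  have ph: "phase l N (x u) = u" if "u \<ge> 0" for u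
    using that assms by (simp add: phase_def x_def real_sqrt_abs)
  have xN: "N\<^sup>2 \<le> x u" for u
    unfolding x_def using assms by (intro power_mono) auto
  have xx: "x u < x v"
    using phase_mono[of l "x v" "x u" N] ph[of u] ph[of v] uv assms(1)
    by (cases "x u" "x v" rule: linorder_cases) auto
  have s: "0 < e * G (x u)" "e * G (x v) < 0" using sgn xN ph uv by simp_all
  have "continuous_on {x u..x v} (\<lambda>z. e * G z)"
    using G by (intro continuous_intros) (auto intro: continuous_on_subset)
  then obtain z where z: "x u \<le> z" "z \<le> x v" "e * G z = 0"
    using IVT2'[of "\<lambda>z. e * G z" "x v" 0 "x u"] s xx by force
  have "e \<noteq> 0" using s by auto
  then have "G z = 0" using z by simp
  moreover have "x u < z" "z < x v" using z s by (metis less_irrefl order_le_less)+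
  moreover have "u < phase l N z" "phase l N z < v"
    using phase_mono[OF assms(1) \<open>x u < z\<close>, of N] phase_mono[OF assms(1) \<open>z < x v\<close>, of N] ph uv by auto
  ultimately show ?thesis using xN[of u] by (intro exI[of _ z]) auto
qed

text \<open>At a pole the value \<open>tan = 0\<close> leaves only the positive term of \<open>Psi\<close>.\<close>

lemma cos_phase_nonzero_Psi:
  assumes "n \<ge> 1" "l > 0" "lam > real n ^ 4" "Psi n lam l = 0"
  shows "cos (phase l ((real n)\<^sup>2) lam) \<noteq> 0"
proof
  assume "cos (phase l ((real n)\<^sup>2) lam) = 0"
  then have "tan (l * sqrt (sqrt lam - (real n)\<^sup>2)) = 0" by (simp add: tan_def phase_def)
  moreover have s: "sqrt lam > (real n)\<^sup>2" "(real n)\<^sup>2 > 0" using sqrt_above assms by auto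
  then have "sqrt lam + (real n)\<^sup>2 > 0" by linarith
  moreover have "sqrt lam + (1 - sigma) * (real n)\<^sup>2 > 0"
    using s unfolding one_minus_sigma by linarith
  ultimately have "Psi n lam l > 0"
    unfolding Psi_def using assms(2) s \<open>sqrt lam + (real n)\<^sup>2 > 0\<close>
    by (simp)
  then show False using assms by simp
qed

lemma tan_phase_neg_Upsilon:
  assumes "m \<ge> 1" "l > 0" "lam > real m ^ 4" "Upsilon m lam l = 0"
  shows "tan (phase l ((real m)\<^sup>2) lam) < 0"
proof (rule ccontr)
  assume "\<not> tan (phase l ((real m)\<^sup>2) lam) < 0"
  then have t: "tan (l * sqrt (sqrt lam - (real m)\<^sup>2)) \<ge> 0" by (simp add: phase_def)
  have s: "sqrt lam > (real m)\<^sup>2" "(real m)\<^sup>2 > 0" using sqrt_above assms by auto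
  then have "sqrt lam + (real m)\<^sup>2 > 0" by linarith
  have "sqrt lam - (1 - sigma) * (real m)\<^sup>2 > 0"
    using s unfolding one_minus_sigma by linarith
  then have "Upsilon m lam l > 0"
    unfolding Upsilon_def using assms(2) t s \<open>sqrt lam + (real m)\<^sup>2 > 0\<close>
    by (intro add_nonneg_pos mult_nonneg_nonneg mult_pos_pos) auto
  then show False using assms by simp
qed

text \<open>Each branch of the tangent with index \<open>i \<ge> 1\<close> holds exactly one zero of \<open>Psi\<close>, in its right half.
  Branch \<open>0\<close> holds at most one; whether it does depends on \<open>l\<close> and \<open>n\<close>, but this does not matter for
  the numbering.\<close>

lemma Psi_ex1_root:
  assumes n: "n \<ge> 1" and l: "l > 0" and k: "k \<ge> 1"
  shows "\<exists>!x. nth_root_above (\<lambda>lam. Psi n lam l) (real n ^ 4) k x"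
proof -
  define N c where "N = (real n)\<^sup>2" and "c = (1 - sigma) * N"
  have N: "N > 0" "0 < c" "c < N" using n by (simp_all add: N_def c_def sigma_def)
  let ?Z = "{y. real n ^ 4 < y \<and> Psi n y l = 0}"
  have Z: "N < sqrt x \<and> Psi_reduced l c N (sqrt x) = 0 \<and> cos (phase l N x) \<noteq> 0"
    if "x \<in> ?Z" for x
  proof -
    have x: "N < sqrt x" "c < sqrt x" using that sqrt_above[of n x] N by (auto simp: N_def)
    then have "sqrt x + N > 0" using N by linarith
    then have "Psi_reduced l c N (sqrt x) = 0"
      using that x Psi_factor[of x n l] by (simp add: N_def c_def)
    then show ?thesis using x cos_phase_nonzero_Psi[OF n l] that by (simp add: N_def)
  qed
  show ?thesis
  proof (rule nth_root_above_ex1[where cell = "\<lambda>x. tan_cell (phase l N x)"])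
    fix x assume "x \<in> ?Z"
    then show "0 \<le> tan_cell (phase l N x)"
      using Z[of x] l by (intro tan_cell_nonneg) (simp add: phase_def)
  next
    fix x y assume xy: "x \<in> ?Z" "y \<in> ?Z" "x < y"
    then show "tan_cell (phase l N x) \<le> tan_cell (phase l N y)"
      using phase_mono[OF l, of x y N] by (intro tan_cell_mono) simp
    show "tan_cell (phase l N x) \<noteq> tan_cell (phase l N y)"
    proof
      assume same: "tan_cell (phase l N x) = tan_cell (phase l N y)"
      note zx = Z[OF xy(1)] and zy = Z[OF xy(2)]
      have "\<exists>d<0. (Psi_reduced l c N has_real_derivative d) (at w)"
        if w: "sqrt x \<le> w" "w \<le> sqrt y" for w
      proof (rule Psi_reduced_deriv)
        show "cos (l * sqrt (w - N)) \<noteq> 0"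
        proof (rule cos_nonzero_in_tan_cell[OF _ _ same])
          show "phase l N x \<le> l * sqrt (w - N)" "l * sqrt (w - N) \<le> phase l N y"
            using w l by (simp_all add: phase_def)
        qed (use zx zy in simp_all)
      qed (use l N zx w in auto)
      then have "\<not> sqrt x < sqrt y" using zx zy
        by (intro no_two_zeros_if_deriv_neg[of _ _ "Psi_reduced l c N"]) simp_all
      then show False using xy by simp
    qed
  next
    fix i :: nat assume i: "i \<ge> 1"
    define e :: real where "e = (-1) ^ i"
    have ee: "e * e = 1" by (simp add: e_def flip: power_mult_distrib)
    have trig: "sin (real i * pi) = 0" "cos (real i * pi) = e" by (simp_all add: e_def)
    \<comment> \<open>\<open>Psi\<close> multiplied by the cosine of the phase, which removes the poles\<close>
    let ?G = "\<lambda>lam. sqrt (sqrt lam - N) * (sqrt lam + c)\<^sup>2 * tanh (l * sqrt (sqrt lam + N)) * cos (phase l N lam)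
       - sqrt (sqrt lam + N) * (sqrt lam - c)\<^sup>2 * sin (phase l N lam)"
    have "\<exists>z>N\<^sup>2. ?G z = 0 \<and> real i * pi < phase l N z \<and> phase l N z < real i * pi + pi / 2"
    proof (rule phase_crossing[OF l N(1), where e = e])
      show "continuous_on UNIV ?G"
        unfolding phase_def by (intro continuous_intros) (auto simp: cosh_real_nonzero)
    next
      fix x assume x: "phase l N x = real i * pi" "N\<^sup>2 \<le> x"
      let ?K = "sqrt (sqrt x - N) * (sqrt x + c)\<^sup>2 * tanh (l * sqrt (sqrt x + N))"
      have "phase l N x > 0" using x(1) i by simp
      then have "sqrt (sqrt x - N) > 0" using l by (simp add: phase_def zero_less_mult_iff)
      moreover have "sqrt x \<ge> N" using x(2) by (rule real_le_rsqrt)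
      ultimately have "?K > 0" using N l by (intro mult_pos_pos zero_less_power) auto
      moreover have "e * ?G x = (e * e) * ?K" unfolding x(1) trig by (simp add: mult_ac)
      ultimately show "0 < e * ?G x" unfolding ee by simp
    next
      fix x assume x: "phase l N x = real i * pi + pi / 2" "N\<^sup>2 \<le> x"
      let ?K = "sqrt (sqrt x + N) * (sqrt x - c)\<^sup>2"
      have "N \<le> sqrt x" using x(2) by (rule real_le_rsqrt)
      then have "?K > 0" using N by (intro mult_pos_pos zero_less_power) auto
      moreover have "e * ?G x = - ((e * e) * ?K)"
        unfolding x(1) sin_add cos_add trig by (simp add: mult_ac)
      ultimately show "e * ?G x < 0" unfolding ee by simp
    qed simp_all
    then obtain z where z: "z > N\<^sup>2" "?G z = 0" "real i * pi < phase l N z" "phase l N z < real i * pi + pi / 2"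
      by blast
    have cell: "tan_cell (phase l N z) = int i" using z by (intro tan_cell_eq) (use pi_gt_zero in linarith)+
    have "cos (phase l N z) \<noteq> 0"
    proof
      assume "cos (phase l N z) = 0"
      then obtain j :: int where j: "phase l N z = of_int j * pi + pi / 2" using cos_zero_iff_int2 by blast
      have "tan_cell (phase l N z) = j + 1" unfolding j by (rule tan_cell_at_pole)
      then have "of_int j = real i - 1" using cell by linarith
      then have "of_int j * pi = real i * pi - pi" by (simp add: left_diff_distrib)
      with j z(3) pi_gt_zero show False by linarith
    qed
    then have "Psi n z l = ?G z / cos (phase l N z)"
      unfolding Psi_def N_def[symmetric] c_def[symmetric] phase_def[symmetric]
      by (simp add: tan_def field_simps)
    then have "z \<in> ?Z" using z by (simp add: N_def)
    with cell show "\<exists>x\<in>?Z. tan_cell (phase l N x) = int i" by blast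
  qed (use k in auto)
qed

text \<open>Each branch of the tangent with index \<open>i \<ge> 1\<close> holds exactly one zero of \<open>Upsilon\<close>, in its left
  half, where the tangent is negative; branch \<open>0\<close> holds none, because phases are positive.\<close>

lemma Upsilon_ex1_root:
  assumes m: "m \<ge> 1" and l: "l > 0" and k: "k \<ge> 1"
  shows "\<exists>!x. nth_root_above (\<lambda>lam. Upsilon m lam l) (real m ^ 4) k x"
proof -
  define N c where "N = (real m)\<^sup>2" and "c = (1 - sigma) * N"
  have N: "N > 0" "0 < c" "c < N" using m by (simp_all add: N_def c_def sigma_def)
  let ?Z = "{y. real m ^ 4 < y \<and> Upsilon m y l = 0}"
  have Z: "N < sqrt x \<and> Upsilon_reduced l c N (sqrt x) = 0 \<and> tan (phase l N x) < 0 \<and> cos (phase l N x) \<noteq> 0"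
    if "x \<in> ?Z" for x
  proof -
    have x: "N < sqrt x" "c < sqrt x" using that sqrt_above[of m x] N by (auto simp: N_def)
    then have "Upsilon_reduced l c N (sqrt x) = 0"
      using that Upsilon_factor[of x m l] by (simp add: N_def c_def)
    moreover have "tan (phase l N x) < 0" using tan_phase_neg_Upsilon[OF m l] that by (simp add: N_def)
    moreover from this have "cos (phase l N x) \<noteq> 0" by (auto simp: tan_def)
    ultimately show ?thesis using x by simp
  qed
  show ?thesis
  proof (rule nth_root_above_ex1[where cell = "\<lambda>x. tan_cell (phase l N x)"])
    fix x assume "x \<in> ?Z"
    then show "0 \<le> tan_cell (phase l N x)"
      using Z[of x] l by (intro tan_cell_nonneg) (simp add: phase_def)
  next
    fix x y assume xy: "x \<in> ?Z" "y \<in> ?Z" "x < y"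
    then show "tan_cell (phase l N x) \<le> tan_cell (phase l N y)"
      using phase_mono[OF l, of x y N] by (intro tan_cell_mono) simp
    show "tan_cell (phase l N x) \<noteq> tan_cell (phase l N y)"
    proof
      assume same: "tan_cell (phase l N x) = tan_cell (phase l N y)"
      note zx = Z[OF xy(1)] and zy = Z[OF xy(2)]
      have "\<exists>d>0. (Upsilon_reduced l c N has_real_derivative d) (at w)"
        if w: "sqrt x \<le> w" "w \<le> sqrt y" for w
      proof (rule Upsilon_reduced_deriv)
        let ?p = "l * sqrt (w - N)"
        have p: "phase l N x \<le> ?p" "?p \<le> phase l N y" using w l by (auto simp: phase_def)
        show c: "cos ?p \<noteq> 0"
          using cos_nonzero_in_tan_cell[OF _ _ same p] zx zy by simp
        have "tan_cell ?p = tan_cell (phase l N y)"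
          using tan_cell_mono[OF p(1)] tan_cell_mono[OF p(2)] same by simp
        then have "tan ?p \<le> tan (phase l N y)"
          using tan_strict_mono_in_tan_cell[OF c, of "phase l N y"] zy p(2)
          by (cases "?p = phase l N y") auto
        then show "tan ?p < 0" using zy by simp
      qed (use l N zx w in auto)
      then have "\<not> sqrt x < sqrt y" using zx zy
        by (intro no_two_zeros_if_deriv_pos[of _ _ "Upsilon_reduced l c N"]) simp_all
      then show False using xy by simp
    qed
  next
    fix i :: nat assume i: "i \<ge> 1"
    define e :: real where "e = (-1) ^ i"
    have ee: "e * e = 1" by (simp add: e_def flip: power_mult_distrib)
    have trig: "sin (real i * pi) = 0" "cos (real i * pi) = e" by (simp_all add: e_def)
    \<comment> \<open>\<open>Upsilon\<close> multiplied by the cosine of the phase, which removes the poles\<close>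
    let ?G = "\<lambda>lam. sqrt (sqrt lam - N) * (sqrt lam + c)\<^sup>2 * sin (phase l N lam)
       + sqrt (sqrt lam + N) * (sqrt lam - c)\<^sup>2 * tanh (l * sqrt (sqrt lam + N)) * cos (phase l N lam)"
    have i1: "real i * pi \<ge> pi" using i pi_gt_zero by simp
    have "\<exists>z>N\<^sup>2. ?G z = 0 \<and> real i * pi - pi / 2 < phase l N z \<and> phase l N z < real i * pi"
    proof (rule phase_crossing[OF l N(1), where e = "- e"])
      show "continuous_on UNIV ?G"
        unfolding phase_def by (intro continuous_intros) (auto simp: cosh_real_nonzero)
    next
      fix x assume x: "phase l N x = real i * pi - pi / 2" "N\<^sup>2 \<le> x"
      let ?K = "sqrt (sqrt x - N) * (sqrt x + c)\<^sup>2"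
      have "phase l N x > 0" using x(1) i1 pi_gt_zero by linarith
      then have "sqrt (sqrt x - N) > 0" using l by (simp add: phase_def zero_less_mult_iff)
      moreover have "sqrt x \<ge> N" using x(2) by (rule real_le_rsqrt)
      ultimately have "?K > 0" using N by (intro mult_pos_pos zero_less_power) auto
      moreover have "- e * ?G x = (e * e) * ?K"
        unfolding x(1) sin_diff cos_diff trig by (simp add: mult_ac)
      ultimately show "0 < - e * ?G x" unfolding ee by simp
    next
      fix x assume x: "phase l N x = real i * pi" "N\<^sup>2 \<le> x"
      let ?K = "sqrt (sqrt x + N) * (sqrt x - c)\<^sup>2 * tanh (l * sqrt (sqrt x + N))"
      have "N \<le> sqrt x" using x(2) by (rule real_le_rsqrt)
      then have "?K > 0" using N l by (intro mult_pos_pos zero_less_power) auto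
      moreover have "- e * ?G x = - ((e * e) * ?K)" unfolding x(1) trig by (simp add: mult_ac)
      ultimately show "- e * ?G x < 0" unfolding ee by simp
    qed (use i1 pi_gt_zero in linarith)+
    then obtain z where z: "z > N\<^sup>2" "?G z = 0" "real i * pi - pi / 2 < phase l N z" "phase l N z < real i * pi"
      by blast
    have cell: "tan_cell (phase l N z) = int i" using z by (intro tan_cell_eq) (use pi_gt_zero in linarith)+
    have "cos (phase l N z) \<noteq> 0"
    proof
      assume "cos (phase l N z) = 0"
      then obtain j :: int where j: "phase l N z = of_int j * pi + pi / 2" using cos_zero_iff_int2 by blast
      have "tan_cell (phase l N z) = j + 1" unfolding j by (rule tan_cell_at_pole)
      then have "of_int j = real i - 1" using cell by linarith
      with j z(3) show False by (simp add: algebra_simps)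
    qed
    then have "Upsilon m z l = ?G z / cos (phase l N z)"
      unfolding Upsilon_def N_def[symmetric] c_def[symmetric] phase_def[symmetric]
      by (simp add: tan_def field_simps)
    then have "z \<in> ?Z" using z by (simp add: N_def)
    with cell show "\<exists>x\<in>?Z. tan_cell (phase l N x) = int i" by blast
  qed (use k in auto)
qed

section \<open>Nondegenerate zeros and the derivative formula\<close>

text \<open>\<open>nondegenerate_zero F a b\<close>: the equation \<open>F x l = 0\<close> can be solved smoothly for \<open>x\<close> near \<open>(a, b)\<close>;
  regularity of \<open>F\<close> is expressed by being elementary on a neighbourhood.\<close>

definition nondegenerate_zero :: "(real \<Rightarrow> real \<Rightarrow> real) \<Rightarrow> real \<Rightarrow> real \<Rightarrow> bool" where
  "nondegenerate_zero F a b \<longleftrightarrow> F a b = 0 \<and> partial_fst F a b \<noteq> 0 \<and>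
     (\<exists>W. open W \<and> (a, b) \<in> W \<and> elementary W (\<lambda>p. F (fst p) (snd p)))"

lemma Phi_nondegenerate:
  assumes "m \<ge> 1" "l > 0"
    and root: "root_between (\<lambda>lam. Phi m lam l) ((1 - sigma^2) * real m ^ 4) (real m ^ 4) a"
  shows "nondegenerate_zero (Phi m) a l"
  unfolding nondegenerate_zero_def
proof (intro conjI exI)
  define N c where "N = (real m)\<^sup>2" and "c = (1 - sigma) * N"
  have w: "0 < a" "0 < c" "c < sqrt a" "sqrt a < N"
    using sqrt_window[of m a] assms by (simp_all add: root_between_def N_def c_def)
  show a0: "Phi m a l = 0" using root by (simp add: root_between_def)
  obtain d where d: "d < 0" "(Phi_reduced l c N has_real_derivative d) (at (sqrt a))"
    using Phi_reduced_deriv[OF assms(2)] w by blast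
  have "\<forall>\<^sub>F x in nhds a. sqrt x > c"
    using w by (intro order_tendstoD(1)[OF tendsto_real_sqrt[OF filterlim_ident]]) auto
  then have "\<forall>\<^sub>F x in nhds a. Phi m x l = (sqrt x - c)\<^sup>2 * Phi_reduced l c N (sqrt x)"
    by eventually_elim (use Phi_factor[of _ m l] in \<open>auto simp: N_def c_def\<close>)
  then show "partial_fst (Phi m) a l \<noteq> 0"
    unfolding partial_fst_def
    by (rule deriv_nonzero_of_factor[OF w(1), where Q = "\<lambda>s. (s - c)\<^sup>2" and d = d])
       (use w d a0 in \<open>auto intro!: continuous_intros\<close>)
  let ?W = "{p. 0 < fst p \<and> sqrt (fst p) < N}"
  show "open ?W" by (intro open_Collect_conj open_Collect_less continuous_intros)
  show "(a, l) \<in> ?W" using w by simp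
  show "elementary ?W (\<lambda>p. Phi m (fst p) (snd p))"
    unfolding Phi_def N_def[symmetric]
    by (intro elementary_rules) (auto simp: add_nonneg_pos N_def assms)
qed

lemma Gamma_nondegenerate:
  assumes "n \<ge> 1" "l > 0"
    and root: "root_between (\<lambda>lam. Gamma_fun n lam l) ((1 - sigma^2) * real n ^ 4) (real n ^ 4) a"
  shows "nondegenerate_zero (Gamma_fun n) a l"
  unfolding nondegenerate_zero_def
proof (intro conjI exI)
  define N c where "N = (real n)\<^sup>2" and "c = (1 - sigma) * N"
  have w: "0 < a" "0 < c" "c < sqrt a" "sqrt a < N"
    using sqrt_window[of n a] assms by (simp_all add: root_between_def N_def c_def)
  show a0: "Gamma_fun n a l = 0" using root by (simp add: root_between_def)
  obtain d where d: "d < 0" "(Gamma_reduced l c N has_real_derivative d) (at (sqrt a))"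
    using Gamma_reduced_deriv[OF assms(2)] w by blast
  let ?Q = "\<lambda>s. sqrt (N - s) * sqrt (s + N) * (s - c)\<^sup>2"
  have "\<forall>\<^sub>F x in nhds a. sqrt x > c \<and> sqrt x < N"
    using w by (intro eventually_conj order_tendstoD[OF tendsto_real_sqrt[OF filterlim_ident]]) auto
  then have "\<forall>\<^sub>F x in nhds a. Gamma_fun n x l = ?Q (sqrt x) * Gamma_reduced l c N (sqrt x)"
  proof eventually_elim
    case (elim x)
    then have "sqrt x \<noteq> c" "0 < sqrt x" using w by linarith+
    then show ?case using Gamma_factor[of x n l] elim by (simp add: N_def c_def)
  qed
  then show "partial_fst (Gamma_fun n) a l \<noteq> 0"
    unfolding partial_fst_def
    by (rule deriv_nonzero_of_factor[OF w(1), where Q = ?Q and d = d])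
       (use w d a0 in \<open>auto intro!: continuous_intros\<close>)
  let ?W = "{p. 0 < fst p \<and> sqrt (fst p) < N}"
  show "open ?W" by (intro open_Collect_conj open_Collect_less continuous_intros)
  show "(a, l) \<in> ?W" using w by simp
  show "elementary ?W (\<lambda>p. Gamma_fun n (fst p) (snd p))"
    unfolding Gamma_fun_def N_def[symmetric]
    by (intro elementary_rules) (auto simp: add_nonneg_pos add_pos_nonneg N_def assms)
qed

lemma Psi_nondegenerate:
  assumes "n \<ge> 1" "l > 0" and root: "a > real n ^ 4" "Psi n a l = 0"
  shows "nondegenerate_zero (Psi n) a l"
  unfolding nondegenerate_zero_def
proof (intro conjI exI)
  define N c where "N = (real n)\<^sup>2" and "c = (1 - sigma) * N"
  have N: "N > 0" "0 < c" "c < N" using assms by (simp_all add: N_def c_def sigma_def)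
  have w: "0 < a" "N < sqrt a" "cos (l * sqrt (sqrt a - N)) \<noteq> 0"
    using sqrt_above[of n a] cos_phase_nonzero_Psi[OF assms] root
    by (auto simp: N_def phase_def intro: le_less_trans[rotated])
  show a0: "Psi n a l = 0" by (rule root)
  obtain d where d: "d < 0" "(Psi_reduced l c N has_real_derivative d) (at (sqrt a))"
    using Psi_reduced_deriv[OF assms(2) N(2,3) w(2,3)] by blast
  let ?Q = "\<lambda>s. sqrt (s - N) * sqrt (s + N) * (s - c)\<^sup>2"
  have "\<forall>\<^sub>F x in nhds a. sqrt x > N"
    using w by (intro order_tendstoD[OF tendsto_real_sqrt[OF filterlim_ident]]) auto
  then have "\<forall>\<^sub>F x in nhds a. Psi n x l = ?Q (sqrt x) * Psi_reduced l c N (sqrt x)"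
  proof eventually_elim
    case (elim x)
    then have "sqrt x \<noteq> c" using N by linarith
    then show ?case using Psi_factor[of x n l] elim by (simp add: N_def c_def)
  qed
  then show "partial_fst (Psi n) a l \<noteq> 0"
    unfolding partial_fst_def
    by (rule deriv_nonzero_of_factor[OF w(1), where Q = ?Q and d = d])
       (use w N d a0 in \<open>auto intro!: continuous_intros\<close>)
  let ?W = "{p. 0 < fst p \<and> N < sqrt (fst p) \<and> cos (snd p * sqrt (sqrt (fst p) - N)) \<noteq> 0}"
  show "open ?W"
    by (intro open_Collect_conj open_Collect_less open_Collect_neq continuous_intros)
  show "(a, l) \<in> ?W" using w by simp
  show "elementary ?W (\<lambda>p. Psi n (fst p) (snd p))"
    unfolding Psi_def N_def[symmetric]
    by (intro elementary_rules) (use N in \<open>auto simp: add_nonneg_pos add_pos_nonneg\<close>)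
qed

lemma Upsilon_nondegenerate:
  assumes "m \<ge> 1" "l > 0" and root: "a > real m ^ 4" "Upsilon m a l = 0"
  shows "nondegenerate_zero (Upsilon m) a l"
  unfolding nondegenerate_zero_def
proof (intro conjI exI)
  define N c where "N = (real m)\<^sup>2" and "c = (1 - sigma) * N"
  have N: "N > 0" "0 < c" "c < N" using assms by (simp_all add: N_def c_def sigma_def)
  have t: "tan (l * sqrt (sqrt a - N)) < 0"
    using tan_phase_neg_Upsilon[OF assms] by (simp add: N_def phase_def)
  then have "cos (l * sqrt (sqrt a - N)) \<noteq> 0" by (auto simp: tan_def)
  then have w: "0 < a" "N < sqrt a" "cos (l * sqrt (sqrt a - N)) \<noteq> 0"
    using sqrt_above[of m a] root
    by (auto simp: N_def intro: le_less_trans[rotated])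
  show a0: "Upsilon m a l = 0" by (rule root)
  obtain d where d: "d > 0" "(Upsilon_reduced l c N has_real_derivative d) (at (sqrt a))"
    using Upsilon_reduced_deriv[OF assms(2) N(2,3) w(2,3) t] by blast
  have "\<forall>\<^sub>F x in nhds a. sqrt x > N"
    using w by (intro order_tendstoD[OF tendsto_real_sqrt[OF filterlim_ident]]) auto
  then have "\<forall>\<^sub>F x in nhds a. Upsilon m x l = (sqrt x - c)\<^sup>2 * Upsilon_reduced l c N (sqrt x)"
  proof eventually_elim
    case (elim x)
    then have "sqrt x \<noteq> c" using N by linarith
    then show ?case using Upsilon_factor[of x m l] elim by (simp add: N_def c_def)
  qed
  then show "partial_fst (Upsilon m) a l \<noteq> 0"
    unfolding partial_fst_def
    by (rule deriv_nonzero_of_factor[OF w(1), where Q = "\<lambda>s. (s - c)\<^sup>2" and d = d])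
       (use w N d a0 in \<open>auto intro!: continuous_intros\<close>)
  let ?W = "{p. 0 < fst p \<and> N < sqrt (fst p) \<and> cos (snd p * sqrt (sqrt (fst p) - N)) \<noteq> 0}"
  show "open ?W"
    by (intro open_Collect_conj open_Collect_less open_Collect_neq continuous_intros)
  show "(a, l) \<in> ?W" using w by simp
  show "elementary ?W (\<lambda>p. Upsilon m (fst p) (snd p))"
    unfolding Upsilon_def N_def[symmetric]
    by (intro elementary_rules) (use N in \<open>auto simp: add_nonneg_pos add_pos_nonneg\<close>)
qed

lemma mubar_nondegenerate:
  assumes "m \<ge> 1" "k \<ge> 1"
  shows "nondegenerate_zero (if k = 1 then Phi m else Upsilon m) (mubar m k) (pi/150)"
proof (cases "k = 1")
  case True
  have "root_between (\<lambda>lam. Phi m lam (pi/150)) ((1 - sigma^2) * real m ^ 4) (real m ^ 4) (mubar m 1)"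
    unfolding mubar_def using theI'[OF Phi_ex1_root[OF assms(1), of "pi/150"]] by simp
  with Phi_nondegenerate[OF assms(1)] True show ?thesis by simp
next
  case False
  then have "nth_root_above (\<lambda>lam. Upsilon m lam (pi/150)) (real m ^ 4) (k - 1) (mubar m k)"
    unfolding mubar_def
    using theI'[OF Upsilon_ex1_root[OF assms(1), of "pi/150" "k - 1"]] assms by simp
  with Upsilon_nondegenerate[OF assms(1)] False show ?thesis by (simp add: nth_root_above_def)
qed

lemma nubar_nondegenerate:
  assumes "n \<ge> 1" "j \<ge> 1" "j = 1 \<longrightarrow> nubar_one_exists n"
  shows "nondegenerate_zero (if j = 1 then Gamma_fun n else Psi n) (nubar n j) (pi/150)"
proof (cases "j = 1")
  case True
  let ?R = "root_between (\<lambda>lam. Gamma_fun n lam (pi/150)) ((1 - sigma^2) * real n ^ 4) (real n ^ 4)"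
  have "\<exists>!x. ?R x"
    using assms True Gamma_root_unique[OF assms(1), of "pi/150"]
    by (intro ex_ex1I) (auto simp: nubar_one_exists_def)
  from theI'[OF this] have "?R (nubar n 1)" unfolding nubar_def by simp
  with Gamma_nondegenerate[OF assms(1)] True show ?thesis by simp
next
  case False
  then have "nth_root_above (\<lambda>lam. Psi n lam (pi/150)) (real n ^ 4) (j - 1) (nubar n j)"
    unfolding nubar_def
    using theI'[OF Psi_ex1_root[OF assms(1), of "pi/150" "j - 1"]] assms by simp
  with Psi_nondegenerate[OF assms(1)] False show ?thesis by (simp add: nth_root_above_def)
qed

lemma implicit_fun_chain_rule:
  fixes f :: "real \<Rightarrow> real \<Rightarrow> real"
  assumes f: "\<forall>p. (\<lambda>(x, y). f x y) differentiable (at p)"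
    and F: "nondegenerate_zero F a l0" and G: "nondegenerate_zero G b l0"
  shows "(\<forall>\<^sub>F l in nhds l0. (\<lambda>l. f (implicit_fun F a l0 l) (implicit_fun G b l0 l)) differentiable (at l)) \<and>
    ((\<lambda>l. f (implicit_fun F a l0 l) (implicit_fun G b l0 l)) has_real_derivative
      - partial_fst f a b * (partial_snd F a l0 / partial_fst F a l0)
      - partial_snd f a b * (partial_snd G b l0 / partial_fst G b l0)) (at l0)"
proof -
  obtain V where V: "open V" "(a, l0) \<in> V" "elementary V (\<lambda>p. F (fst p) (snd p))"
    "F a l0 = 0" "partial_fst F a l0 \<noteq> 0"
    using F unfolding nondegenerate_zero_def by blast
  obtain W where W: "open W" "(b, l0) \<in> W" "elementary W (\<lambda>p. G (fst p) (snd p))"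
    "G b l0 = 0" "partial_fst G b l0 \<noteq> 0"
    using G unfolding nondegenerate_zero_def by blast
  show ?thesis
    using elementary_implicit_fun[OF V] elementary_implicit_fun[OF W]
    by (intro chain_rule_two_branches f)
qed

theorem theorem3p1:
  fixes m n k j :: nat and f :: "real \<Rightarrow> real \<Rightarrow> real"
  assumes "m \<ge> 1" and "n \<ge> 1" and "k \<ge> 2" and "j \<ge> 2"
    and "\<forall>p. (\<lambda>(x, y). f x y) differentiable (at p)"
  shows "
     (nubar_one_exists n \<longrightarrow>
     (\<forall>\<^sub>F l in nhds (pi/150). (\<lambda>l. f (mu m 1 l) (nu n 1 l)) differentiable (at l)) \<and>
     ((\<lambda>l. f (mu m 1 l) (nu n 1 l)) has_real_derivative
        - partial_fst f (mubar m 1) (nubar n 1) * (partial_snd (Phi m) (mubar m 1) (pi/150) / partial_fst (Phi m) (mubar m 1) (pi/150))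
        - partial_snd f (mubar m 1) (nubar n 1) * (partial_snd (Gamma_fun n) (nubar n 1) (pi/150) / partial_fst (Gamma_fun n) (nubar n 1) (pi/150)))
       (at (pi/150))) \<and>
     (nubar_one_exists n \<longrightarrow>
     (\<forall>\<^sub>F l in nhds (pi/150). (\<lambda>l. f (mu m k l) (nu n 1 l)) differentiable (at l)) \<and>
     ((\<lambda>l. f (mu m k l) (nu n 1 l)) has_real_derivative
        - partial_fst f (mubar m k) (nubar n 1) * (partial_snd (Upsilon m) (mubar m k) (pi/150) / partial_fst (Upsilon m) (mubar m k) (pi/150))
        - partial_snd f (mubar m k) (nubar n 1) * (partial_snd (Gamma_fun n) (nubar n 1) (pi/150) / partial_fst (Gamma_fun n) (nubar n 1) (pi/150)))
       (at (pi/150))) \<and>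
     ((\<forall>\<^sub>F l in nhds (pi/150). (\<lambda>l. f (mu m 1 l) (nu n j l)) differentiable (at l)) \<and>
     ((\<lambda>l. f (mu m 1 l) (nu n j l)) has_real_derivative
        - partial_fst f (mubar m 1) (nubar n j) * (partial_snd (Phi m) (mubar m 1) (pi/150) / partial_fst (Phi m) (mubar m 1) (pi/150))
        - partial_snd f (mubar m 1) (nubar n j) * (partial_snd (Psi n) (nubar n j) (pi/150) / partial_fst (Psi n) (nubar n j) (pi/150)))
       (at (pi/150))) \<and>
     ((\<forall>\<^sub>F l in nhds (pi/150). (\<lambda>l. f (mu m k l) (nu n j l)) differentiable (at l)) \<and>
     ((\<lambda>l. f (mu m k l) (nu n j l)) has_real_derivative
        - partial_fst f (mubar m k) (nubar n j) * (partial_snd (Upsilon m) (mubar m k) (pi/150) / partial_fst (Upsilon m) (mubar m k) (pi/150))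
        - partial_snd f (mubar m k) (nubar n j) * (partial_snd (Psi n) (nubar n j) (pi/150) / partial_fst (Psi n) (nubar n j) (pi/150)))
       (at (pi/150)))"
  using implicit_fun_chain_rule[OF assms(5)]
    mubar_nondegenerate[OF assms(1), of 1] mubar_nondegenerate[OF assms(1), of k]
    nubar_nondegenerate[OF assms(2), of 1] nubar_nondegenerate[OF assms(2), of j] assms(3,4)
  unfolding mu_def nu_def
  by (intro conjI impI; simp)

end
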